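(* Let $\mathcal{A}$ be an abelian category, $n\geq 1$, $I=\{1,\dots,n\}$, let $F=(F_i)_{i\in I}$ be a family of additive covariant endofunctors of $\mathcal{A}$ and let $\Phi=(\Phi_{i,j}:F_iF_j\to F_{i+j})$ be an associative family of natural transformations. If $F_i$ is right exact for every $i\in I$, then the right $n$-trivial extension $\mathcal{A}\ltimes_n F$ is an abelian category.
   Context: The family $\Phi$ consists of natural transformations $\Phi_{i,j}:F_iF_j\to F_{i+j}$, one for each $i,j\in I$ with $i+j\in I$. It is associative if for all $i,j,k\in I$ with $i+j+k\in I$ and every object $X$ of $\mathcal{A}$: $(\Phi_{i,j+k})_X\circ F_i((\Phi_{j,k})_X)=(\Phi_{i+j,k})_X\circ(\Phi_{i,j})_{F_kX}$. The right $n$-trivial extension $\mathcal{A}\ltimes_n F$ (with respect to $\Phi$) is the following category. Objects are pairs $(X,f)$ with $X$ an object of $\mathcal{A}$ and $f=(f_i)_{i\in I}$ a family of morphisms $f_i:F_iX\to X$ such that for all $i,j\in I$: $f_i\circ F_i(f_j)=f_{i+j}\circ(\Phi_{i,j})_X$ if $i+j\leq n$, and $f_i\circ F_i(f_j)=0$ if $i+j>n$. A morphism $(X,\alpha)\to(Y,\beta)$ is a morphism $\gamma:X\to Y$ in $\mathcal{A}$ with $\gamma\circ\alpha_i=\beta_i\circ F_i(\gamma)$ for all $i\in I$. *)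

theory Defs
  imports "HOL-Algebra.Group"
begin

section \<open>Categories with addition on arrows\<close>

text \<open>
  The addition and the zero arrows are part of the record, so that a preadditive structure can
  be imposed on the underlying category; they are unconstrained in the locale \<open>category\<close>.
  The arrow \<open>Comp C g f\<close> is \<open>g\<close> after \<open>f\<close>.
\<close>

record ('o, 'm) cat =
  Obj :: "'o set"
  Arr :: "'m set"
  Dom :: "'m \<Rightarrow> 'o"
  Cod :: "'m \<Rightarrow> 'o"
  Id :: "'o \<Rightarrow> 'm"
  Comp :: "'m \<Rightarrow> 'm \<Rightarrow> 'm"  (infixr \<open>\<cdot>\<index>\<close> 70)
  Add :: "'m \<Rightarrow> 'm \<Rightarrow> 'm"  (infixl \<open>\<boxplus>\<index>\<close> 65)
  Zero :: "'o \<Rightarrow> 'o \<Rightarrow> 'm"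

definition Hom :: "('o, 'm, 'z) cat_scheme \<Rightarrow> 'o \<Rightarrow> 'o \<Rightarrow> 'm set"
  where "Hom C X Y = {f \<in> Arr C. Dom C f = X \<and> Cod C f = Y}"

locale category =
  fixes C :: "('o, 'm, 'z) cat_scheme" (structure)
  assumes Dom_in_Obj: "f \<in> Arr C \<Longrightarrow> Dom C f \<in> Obj C"
    and Cod_in_Obj: "f \<in> Arr C \<Longrightarrow> Cod C f \<in> Obj C"
    and Id_in_Hom: "X \<in> Obj C \<Longrightarrow> Id C X \<in> Hom C X X"
    and Comp_in_Hom: "f \<in> Hom C X Y \<Longrightarrow> g \<in> Hom C Y Z \<Longrightarrow> g \<cdot> f \<in> Hom C X Z"
    and Comp_Id: "f \<in> Hom C X Y \<Longrightarrow> f \<cdot> Id C X = f"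
    and Id_Comp: "f \<in> Hom C X Y \<Longrightarrow> Id C Y \<cdot> f = f"
    and Comp_assoc:
      "f \<in> Hom C W X \<Longrightarrow> g \<in> Hom C X Y \<Longrightarrow> h \<in> Hom C Y Z \<Longrightarrow> (h \<cdot> g) \<cdot> f = h \<cdot> (g \<cdot> f)"

definition hom_group :: "('o, 'm, 'z) cat_scheme \<Rightarrow> 'o \<Rightarrow> 'o \<Rightarrow> 'm monoid"
  where "hom_group C X Y = \<lparr>carrier = Hom C X Y, monoid.mult = Add C, one = Zero C X Y\<rparr>"

locale preadditive_category = category +
  assumes hom_comm_group: "X \<in> Obj C \<Longrightarrow> Y \<in> Obj C \<Longrightarrow> comm_group (hom_group C X Y)"
    and Comp_Add: "f \<in> Hom C X Y \<Longrightarrow> f' \<in> Hom C X Y \<Longrightarrow> g \<in> Hom C Y Z \<Longrightarrow>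
      g \<cdot> (f \<boxplus> f') = (g \<cdot> f) \<boxplus> (g \<cdot> f')"
    and Add_Comp: "f \<in> Hom C X Y \<Longrightarrow> g \<in> Hom C Y Z \<Longrightarrow> g' \<in> Hom C Y Z \<Longrightarrow>
      (g \<boxplus> g') \<cdot> f = (g \<cdot> f) \<boxplus> (g' \<cdot> f)"


section \<open>Abelian categories\<close>

definition is_zero_object :: "('o, 'm, 'z) cat_scheme \<Rightarrow> 'o \<Rightarrow> bool"
  where "is_zero_object C Z \<longleftrightarrow> Z \<in> Obj C \<and>
    (\<forall>X\<in>Obj C. (\<exists>!f. f \<in> Hom C X Z) \<and> (\<exists>!f. f \<in> Hom C Z X))"

definition is_biproduct ::
    "('o, 'm, 'z) cat_scheme \<Rightarrow> 'o \<Rightarrow> 'o \<Rightarrow> 'o \<Rightarrow> 'm \<Rightarrow> 'm \<Rightarrow> 'm \<Rightarrow> 'm \<Rightarrow> bool"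
  where "is_biproduct C X Y S i\<^sub>1 i\<^sub>2 p\<^sub>1 p\<^sub>2 \<longleftrightarrow> S \<in> Obj C \<and>
    i\<^sub>1 \<in> Hom C X S \<and> i\<^sub>2 \<in> Hom C Y S \<and> p\<^sub>1 \<in> Hom C S X \<and> p\<^sub>2 \<in> Hom C S Y \<and>
    p\<^sub>1 \<cdot>\<^bsub>C\<^esub> i\<^sub>1 = Id C X \<and> p\<^sub>2 \<cdot>\<^bsub>C\<^esub> i\<^sub>2 = Id C Y \<and>
    p\<^sub>2 \<cdot>\<^bsub>C\<^esub> i\<^sub>1 = Zero C X Y \<and> p\<^sub>1 \<cdot>\<^bsub>C\<^esub> i\<^sub>2 = Zero C Y X \<and>
    (i\<^sub>1 \<cdot>\<^bsub>C\<^esub> p\<^sub>1) \<boxplus>\<^bsub>C\<^esub> (i\<^sub>2 \<cdot>\<^bsub>C\<^esub> p\<^sub>2) = Id C S"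

definition is_mono :: "('o, 'm, 'z) cat_scheme \<Rightarrow> 'm \<Rightarrow> bool"
  where "is_mono C f \<longleftrightarrow> f \<in> Arr C \<and>
    (\<forall>W. \<forall>g\<in>Hom C W (Dom C f). \<forall>h\<in>Hom C W (Dom C f). f \<cdot>\<^bsub>C\<^esub> g = f \<cdot>\<^bsub>C\<^esub> h \<longrightarrow> g = h)"

definition is_epi :: "('o, 'm, 'z) cat_scheme \<Rightarrow> 'm \<Rightarrow> bool"
  where "is_epi C f \<longleftrightarrow> f \<in> Arr C \<and>
    (\<forall>W. \<forall>g\<in>Hom C (Cod C f) W. \<forall>h\<in>Hom C (Cod C f) W. g \<cdot>\<^bsub>C\<^esub> f = h \<cdot>\<^bsub>C\<^esub> f \<longrightarrow> g = h)"

text \<open>\<open>is_kernel C k f\<close> and \<open>is_cokernel C q f\<close>: the arrow \<open>k\<close> (resp. \<open>q\<close>) is a (co)kernel of \<open>f\<close>.\<close>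

definition is_kernel :: "('o, 'm, 'z) cat_scheme \<Rightarrow> 'm \<Rightarrow> 'm \<Rightarrow> bool"
  where "is_kernel C k f \<longleftrightarrow> f \<in> Arr C \<and> k \<in> Arr C \<and> Cod C k = Dom C f \<and>
    f \<cdot>\<^bsub>C\<^esub> k = Zero C (Dom C k) (Cod C f) \<and>
    (\<forall>W. \<forall>h\<in>Hom C W (Dom C f). f \<cdot>\<^bsub>C\<^esub> h = Zero C W (Cod C f) \<longrightarrow>
      (\<exists>!u. u \<in> Hom C W (Dom C k) \<and> k \<cdot>\<^bsub>C\<^esub> u = h))"

definition is_cokernel :: "('o, 'm, 'z) cat_scheme \<Rightarrow> 'm \<Rightarrow> 'm \<Rightarrow> bool"
  where "is_cokernel C q f \<longleftrightarrow> f \<in> Arr C \<and> q \<in> Arr C \<and> Dom C q = Cod C f \<and>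
    q \<cdot>\<^bsub>C\<^esub> f = Zero C (Dom C f) (Cod C q) \<and>
    (\<forall>W. \<forall>h\<in>Hom C (Cod C f) W. h \<cdot>\<^bsub>C\<^esub> f = Zero C (Dom C f) W \<longrightarrow>
      (\<exists>!u. u \<in> Hom C (Cod C q) W \<and> u \<cdot>\<^bsub>C\<^esub> q = h))"

locale additive_category = preadditive_category +
  assumes ex_zero_object: "\<exists>Z. is_zero_object C Z"
    and ex_biproduct: "X \<in> Obj C \<Longrightarrow> Y \<in> Obj C \<Longrightarrow>
      \<exists>S i\<^sub>1 i\<^sub>2 p\<^sub>1 p\<^sub>2. is_biproduct C X Y S i\<^sub>1 i\<^sub>2 p\<^sub>1 p\<^sub>2"

locale abelian_category = additive_category +
  assumes ex_kernel: "f \<in> Arr C \<Longrightarrow> \<exists>k. is_kernel C k f"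
    and ex_cokernel: "f \<in> Arr C \<Longrightarrow> \<exists>q. is_cokernel C q f"
    and mono_is_kernel: "is_mono C f \<Longrightarrow> \<exists>g. is_kernel C f g"
    and epi_is_cokernel: "is_epi C f \<Longrightarrow> \<exists>g. is_cokernel C f g"


section \<open>Functors and natural transformations\<close>

record ('o, 'm, 'p, 'q) cat_fun =
  onObj :: "'o \<Rightarrow> 'p"
  onArr :: "'m \<Rightarrow> 'q"

definition comp_cat_fun ::
    "('p, 'q, 'r, 's) cat_fun \<Rightarrow> ('o, 'm, 'p, 'q) cat_fun \<Rightarrow> ('o, 'm, 'r, 's) cat_fun"
  where "comp_cat_fun G F = \<lparr>onObj = onObj G \<circ> onObj F, onArr = onArr G \<circ> onArr F\<rparr>"

locale covariant_functor =
  A: category A + B: category B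
  for A :: "('o, 'm, 'y) cat_scheme" and B :: "('p, 'q, 'z) cat_scheme" +
  fixes F :: "('o, 'm, 'p, 'q) cat_fun"
  assumes onObj_in_Obj: "X \<in> Obj A \<Longrightarrow> onObj F X \<in> Obj B"
    and onArr_in_Hom: "f \<in> Hom A X Y \<Longrightarrow> onArr F f \<in> Hom B (onObj F X) (onObj F Y)"
    and onArr_Id: "X \<in> Obj A \<Longrightarrow> onArr F (Id A X) = Id B (onObj F X)"
    and onArr_Comp: "f \<in> Hom A X Y \<Longrightarrow> g \<in> Hom A Y Z \<Longrightarrow>
      onArr F (g \<cdot>\<^bsub>A\<^esub> f) = onArr F g \<cdot>\<^bsub>B\<^esub> onArr F f"

locale additive_functor = covariant_functor +
  assumes onArr_Add: "f \<in> Hom A X Y \<Longrightarrow> g \<in> Hom A X Y \<Longrightarrow>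
    onArr F (f \<boxplus>\<^bsub>A\<^esub> g) = onArr F f \<boxplus>\<^bsub>B\<^esub> onArr F g"

locale natural_transformation =
  F: covariant_functor A B F + G: covariant_functor A B G
  for A :: "('o, 'm, 'y) cat_scheme" and B :: "('p, 'q, 'z) cat_scheme"
    and F G :: "('o, 'm, 'p, 'q) cat_fun" +
  fixes \<tau> :: "'o \<Rightarrow> 'q"
  assumes component_in_Hom: "X \<in> Obj A \<Longrightarrow> \<tau> X \<in> Hom B (onObj F X) (onObj G X)"
    and naturality: "f \<in> Hom A X Y \<Longrightarrow> \<tau> Y \<cdot>\<^bsub>B\<^esub> onArr F f = onArr G f \<cdot>\<^bsub>B\<^esub> \<tau> X"

text \<open>
  Exactness of \<open>X \<rightarrow> Y \<rightarrow> Z\<close> at \<open>Y\<close>: the image of \<open>f\<close>, that is, the kernel \<open>m\<close> of its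
  cokernel \<open>q\<close>, is the kernel of \<open>g\<close>.
\<close>

definition exact_at :: "('o, 'm, 'z) cat_scheme \<Rightarrow> 'm \<Rightarrow> 'm \<Rightarrow> bool"
  where "exact_at C f g \<longleftrightarrow> f \<in> Arr C \<and> g \<in> Arr C \<and> Cod C f = Dom C g \<and>
    (\<exists>q m. is_cokernel C q f \<and> is_kernel C m q \<and> is_kernel C m g)"

text \<open>The sequence \<open>X \<rightarrow> Y \<rightarrow> Z \<rightarrow> 0\<close> with maps \<open>f\<close>, \<open>g\<close> is exact at \<open>Y\<close> and at \<open>Z\<close>.\<close>

definition right_exact_sequence :: "('o, 'm, 'z) cat_scheme \<Rightarrow> 'm \<Rightarrow> 'm \<Rightarrow> bool"
  where "right_exact_sequence C f g \<longleftrightarrow> exact_at C f g \<and>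
    (\<exists>N. is_zero_object C N \<and> exact_at C g (Zero C (Cod C g) N))"

definition right_exact ::
    "('o, 'm, 'y) cat_scheme \<Rightarrow> ('p, 'q, 'z) cat_scheme \<Rightarrow> ('o, 'm, 'p, 'q) cat_fun \<Rightarrow> bool"
  where "right_exact A B F \<longleftrightarrow>
    (\<forall>f g. right_exact_sequence A f g \<longrightarrow> right_exact_sequence B (onArr F f) (onArr F g))"


section \<open>The right \<open>n\<close>-trivial extension\<close>

definition natural_family ::
    "('o, 'm) cat \<Rightarrow> nat \<Rightarrow> (nat \<Rightarrow> ('o, 'm, 'o, 'm) cat_fun) \<Rightarrow> (nat \<Rightarrow> nat \<Rightarrow> 'o \<Rightarrow> 'm) \<Rightarrow> bool"
  where "natural_family A n F \<Phi> \<longleftrightarrow>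
    (\<forall>i\<in>{1..n}. \<forall>j\<in>{1..n}. i + j \<in> {1..n} \<longrightarrow>
      natural_transformation A A (comp_cat_fun (F i) (F j)) (F (i + j)) (\<Phi> i j))"

definition associative_family ::
    "('o, 'm) cat \<Rightarrow> nat \<Rightarrow> (nat \<Rightarrow> ('o, 'm, 'o, 'm) cat_fun) \<Rightarrow> (nat \<Rightarrow> nat \<Rightarrow> 'o \<Rightarrow> 'm) \<Rightarrow> bool"
  where "associative_family A n F \<Phi> \<longleftrightarrow>
    (\<forall>i\<in>{1..n}. \<forall>j\<in>{1..n}. \<forall>k\<in>{1..n}. i + j + k \<in> {1..n} \<longrightarrow> (\<forall>X\<in>Obj A.
      \<Phi> i (j + k) X \<cdot>\<^bsub>A\<^esub> onArr (F i) (\<Phi> j k X) = \<Phi> (i + j) k X \<cdot>\<^bsub>A\<^esub> \<Phi> i j (onObj (F k) X)))"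

text \<open>
  A family \<open>(f\<^sub>i)\<close> indexed by \<open>{1..n}\<close> is an extensional function (undefined outside the index
  set), so that distinct objects of the extension really differ.
\<close>

definition rext_obj ::
    "('o, 'm) cat \<Rightarrow> nat \<Rightarrow> (nat \<Rightarrow> ('o, 'm, 'o, 'm) cat_fun) \<Rightarrow> (nat \<Rightarrow> nat \<Rightarrow> 'o \<Rightarrow> 'm)
      \<Rightarrow> ('o \<times> (nat \<Rightarrow> 'm)) set"
  where "rext_obj A n F \<Phi> = {(X, f). X \<in> Obj A \<and> f \<in> (\<Pi>\<^sub>E i\<in>{1..n}. Hom A (onObj (F i) X) X) \<and>
    (\<forall>i\<in>{1..n}. \<forall>j\<in>{1..n}.
      (i + j \<le> n \<longrightarrow> f i \<cdot>\<^bsub>A\<^esub> onArr (F i) (f j) = f (i + j) \<cdot>\<^bsub>A\<^esub> \<Phi> i j X) \<and>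
      (i + j > n \<longrightarrow>
        f i \<cdot>\<^bsub>A\<^esub> onArr (F i) (f j) = Zero A (onObj (F i) (onObj (F j) X)) X))}"

text \<open>
  The same arrow of \<open>A\<close> may be a morphism between several pairs of objects of the extension,
  hence arrows of the extension carry their domain and codomain. Addition is that of \<open>A\<close>.
\<close>

definition right_trivial_extension ::
    "('o, 'm) cat \<Rightarrow> nat \<Rightarrow> (nat \<Rightarrow> ('o, 'm, 'o, 'm) cat_fun) \<Rightarrow> (nat \<Rightarrow> nat \<Rightarrow> 'o \<Rightarrow> 'm)
      \<Rightarrow> ('o \<times> (nat \<Rightarrow> 'm), ('o \<times> (nat \<Rightarrow> 'm)) \<times> 'm \<times> ('o \<times> (nat \<Rightarrow> 'm))) cat"
  where "right_trivial_extension A n F \<Phi> =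
    \<lparr>Obj = rext_obj A n F \<Phi>,
     Arr = {((X, \<alpha>), \<gamma>, (Y, \<beta>)) | X \<alpha> \<gamma> Y \<beta>.
       (X, \<alpha>) \<in> rext_obj A n F \<Phi> \<and> (Y, \<beta>) \<in> rext_obj A n F \<Phi> \<and> \<gamma> \<in> Hom A X Y \<and>
       (\<forall>i\<in>{1..n}. \<gamma> \<cdot>\<^bsub>A\<^esub> \<alpha> i = \<beta> i \<cdot>\<^bsub>A\<^esub> onArr (F i) \<gamma>)},
     Dom = (\<lambda>(P, \<gamma>, Q). P),
     Cod = (\<lambda>(P, \<gamma>, Q). Q),
     Id = (\<lambda>P. (P, Id A (fst P), P)),
     Comp = (\<lambda>(Q', \<delta>, R) (P, \<gamma>, Q). (P, \<delta> \<cdot>\<^bsub>A\<^esub> \<gamma>, R)),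
     Add = (\<lambda>(P, \<gamma>, Q) (P', \<gamma>', Q'). (P, \<gamma> \<boxplus>\<^bsub>A\<^esub> \<gamma>', Q)),
     Zero = (\<lambda>P Q. (P, Zero A (fst P) (fst Q), Q))\<rparr>"

end

theory Submission
  imports Defs
begin

text \<open>
  The forgetful functor from the extension to \<open>A\<close> creates kernels and cokernels. On the kernel \<open>k\<close> of
  a morphism the actions are determined by factoring \<open>\<alpha>\<^sub>i \<circ> F\<^sub>i(k)\<close> through the monomorphism \<open>k\<close>; on
  the cokernel \<open>q\<close> they are determined by factoring \<open>q \<circ> \<beta>\<^sub>i\<close> through \<open>F\<^sub>i(q)\<close>, which is again a cokernel
  because \<open>F\<^sub>i\<close> is right exact. The defining relations hold after composition with \<open>k\<close>, respectively
  with the epimorphism \<open>F\<^sub>i(F\<^sub>j(q))\<close>, and hence hold outright. Consequently the forgetful functor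
  preserves monomorphisms and epimorphisms, so that normality is inherited from \<open>A\<close>.
\<close>

section \<open>Kernels and cokernels\<close>

text \<open>The two sides are not formally dual. An action is an arrow out of \<open>F i\<close>
  applied to the object. Restricting it along a kernel \<open>k\<close> is a factorization at its
  target, where \<open>k\<close> itself is cancelled. Pushing it down a cokernel \<open>q\<close>
  happens at its source, where only \<open>onArr (F i) q\<close> can be cancelled; right exactness
  is spent there. Since \<open>right_exact\<close> speaks about exact sequences, it is first turned
  into preservation of cokernels. That the forgetful functor preserves monomorphisms is not
  automatic, because a test arrow of \<open>A\<close> need not be equivariant. The single test arrow
  that matters, a kernel of \<open>f\<close> in \<open>A\<close>, does lift, and monicity in the
  extension forces it to vanish. For the same reason normality cannot use an arbitrary arrow of
  \<open>A\<close> having the monomorphism \<open>f\<close> as kernel, since that arrow need not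
  lift; a cokernel of \<open>f\<close> is taken instead. Epimorphisms are treated with kernels and
  cokernels exchanged.\<close>

context category
begin

lemma HomD:
  assumes "f \<in> Hom C X Y"
  shows "f \<in> Arr C" "Dom C f = X" "Cod C f = Y" "X \<in> Obj C" "Y \<in> Obj C"
  using assms Dom_in_Obj Cod_in_Obj by (auto simp: Hom_def)

lemma Arr_Comp [simp]:
  assumes "f \<in> Arr C" "g \<in> Arr C" "Cod C f = Dom C g"
  shows "g \<cdot> f \<in> Arr C" "Dom C (g \<cdot> f) = Dom C f" "Cod C (g \<cdot> f) = Cod C g"
  using Comp_in_Hom[of f "Dom C f" "Cod C f" g "Cod C g"] assms by (auto simp: Hom_def)

lemma Arr_Id [simp]:
  assumes "X \<in> Obj C"
  shows "Id C X \<in> Arr C" "Dom C (Id C X) = X" "Cod C (Id C X) = X"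
  using Id_in_Hom[OF assms] by (auto simp: Hom_def)

lemma Arr_Comp_Id [simp]: "f \<in> Arr C \<Longrightarrow> Dom C f = X \<Longrightarrow> f \<cdot> Id C X = f"
  using Comp_Id by (auto simp: Hom_def)

lemma Arr_Id_Comp [simp]: "f \<in> Arr C \<Longrightarrow> Cod C f = X \<Longrightarrow> Id C X \<cdot> f = f"
  using Id_Comp by (auto simp: Hom_def)

lemma Arr_Comp_assoc:
  assumes "f \<in> Arr C" "g \<in> Arr C" "h \<in> Arr C" "Cod C f = Dom C g" "Cod C g = Dom C h"
  shows "(h \<cdot> g) \<cdot> f = h \<cdot> (g \<cdot> f)"
  using assms Comp_assoc[of f "Dom C f" "Cod C f" g "Cod C g" h "Cod C h"] by (auto simp: Hom_def)

lemma monoD: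
  assumes "is_mono C f" "g \<in> Arr C" "h \<in> Arr C" "Dom C g = Dom C h"
    and "Cod C g = Dom C f" "Cod C h = Dom C f" "f \<cdot> g = f \<cdot> h"
  shows "g = h"
  using assms unfolding is_mono_def Hom_def by blast

lemma epiD:
  assumes "is_epi C f" "g \<in> Arr C" "h \<in> Arr C" "Cod C g = Cod C h"
    and "Dom C g = Cod C f" "Dom C h = Cod C f" "g \<cdot> f = h \<cdot> f"
  shows "g = h"
  using assms unfolding is_epi_def Hom_def by blast

lemma kernelD:
  assumes "is_kernel C k f"
  shows "f \<in> Arr C" "k \<in> Arr C" "Cod C k = Dom C f" "f \<cdot> k = Zero C (Dom C k) (Cod C f)"
  using assms by (auto simp: is_kernel_def)

lemma kernel_factor:
  assumes "is_kernel C k f" "h \<in> Arr C" "Cod C h = Dom C f" "f \<cdot> h = Zero C (Dom C h) (Cod C f)"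
  obtains u where "u \<in> Arr C" "Dom C u = Dom C h" "Cod C u = Dom C k" "k \<cdot> u = h"
proof -
  have "h \<in> Hom C (Dom C h) (Dom C f)"
    using assms by (simp add: Hom_def)
  then obtain u where "u \<in> Hom C (Dom C h) (Dom C k)" "k \<cdot> u = h"
    using assms unfolding is_kernel_def by blast
  then show thesis
    using that by (auto simp: Hom_def)
qed

lemma cokernelD:
  assumes "is_cokernel C q f"
  shows "f \<in> Arr C" "q \<in> Arr C" "Dom C q = Cod C f" "q \<cdot> f = Zero C (Dom C f) (Cod C q)"
  using assms by (auto simp: is_cokernel_def)

lemma cokernel_factor:
  assumes "is_cokernel C q f" "h \<in> Arr C" "Dom C h = Cod C f" "h \<cdot> f = Zero C (Dom C f) (Cod C h)"
  obtains u where "u \<in> Arr C" "Dom C u = Cod C q" "Cod C u = Cod C h" "u \<cdot> q = h"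
proof -
  have "h \<in> Hom C (Cod C f) (Cod C h)"
    using assms by (simp add: Hom_def)
  then obtain u where "u \<in> Hom C (Cod C q) (Cod C h)" "u \<cdot> q = h"
    using assms unfolding is_cokernel_def by blast
  then show thesis
    using that by (auto simp: Hom_def)
qed

text \<open>Monicity of \<open>k\<close> takes care of uniqueness, so only the existence of
  factorizations remains to be checked.\<close>

lemma kernelI:
  assumes "f \<in> Arr C" "is_mono C k" "Cod C k = Dom C f" "f \<cdot> k = Zero C (Dom C k) (Cod C f)"
    and "\<And>h. h \<in> Arr C \<Longrightarrow> Cod C h = Dom C f \<Longrightarrow> f \<cdot> h = Zero C (Dom C h) (Cod C f) \<Longrightarrow>
      \<exists>u\<in>Arr C. Dom C u = Dom C h \<and> Cod C u = Dom C k \<and> k \<cdot> u = h"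
  shows "is_kernel C k f"
  unfolding is_kernel_def
proof (intro conjI allI ballI impI)
  show "k \<in> Arr C"
    using assms(2) by (simp add: is_mono_def)
  fix W h assume h: "h \<in> Hom C W (Dom C f)" "f \<cdot> h = Zero C W (Cod C f)"
  then obtain u where "u \<in> Arr C" "Dom C u = W" "Cod C u = Dom C k" "k \<cdot> u = h"
    using assms(5)[of h] by (auto simp: Hom_def)
  then show "\<exists>!u. u \<in> Hom C W (Dom C k) \<and> k \<cdot> u = h"
    using monoD[OF assms(2)] by (intro ex1I[of _ u]) (auto simp: Hom_def)
qed (use assms in auto)

lemma cokernelI:
  assumes "f \<in> Arr C" "is_epi C q" "Dom C q = Cod C f" "q \<cdot> f = Zero C (Dom C f) (Cod C q)"
    and "\<And>h. h \<in> Arr C \<Longrightarrow> Dom C h = Cod C f \<Longrightarrow> h \<cdot> f = Zero C (Dom C f) (Cod C h) \<Longrightarrow>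
      \<exists>u\<in>Arr C. Dom C u = Cod C q \<and> Cod C u = Cod C h \<and> u \<cdot> q = h"
  shows "is_cokernel C q f"
  unfolding is_cokernel_def
proof (intro conjI allI ballI impI)
  show "q \<in> Arr C"
    using assms(2) by (simp add: is_epi_def)
  fix W h assume h: "h \<in> Hom C (Cod C f) W" "h \<cdot> f = Zero C (Dom C f) W"
  then obtain u where "u \<in> Arr C" "Dom C u = Cod C q" "Cod C u = W" "u \<cdot> q = h"
    using assms(5)[of h] by (auto simp: Hom_def)
  then show "\<exists>!u. u \<in> Hom C (Cod C q) W \<and> u \<cdot> q = h"
    using epiD[OF assms(2)] by (intro ex1I[of _ u]) (auto simp: Hom_def)
qed (use assms in auto)

end

section \<open>Zero arrows, cancellation tests and kernels in preadditive categories\<close>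

context preadditive_category
begin

lemma Arr_Zero [simp]:
  assumes "X \<in> Obj C" "Y \<in> Obj C"
  shows "Zero C X Y \<in> Arr C" "Dom C (Zero C X Y) = X" "Cod C (Zero C X Y) = Y"
proof -
  interpret G: comm_group "hom_group C X Y"
    by (rule hom_comm_group[OF assms])
  show "Zero C X Y \<in> Arr C" "Dom C (Zero C X Y) = X" "Cod C (Zero C X Y) = Y"
    using G.one_closed by (auto simp: hom_group_def Hom_def)
qed

lemma Arr_Add [simp]:
  assumes "f \<in> Arr C" "g \<in> Arr C" "Dom C f = Dom C g" "Cod C f = Cod C g"
  shows "f \<boxplus> g \<in> Arr C" "Dom C (f \<boxplus> g) = Dom C g" "Cod C (f \<boxplus> g) = Cod C g"
proof -
  interpret G: comm_group "hom_group C (Dom C f) (Cod C f)"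
    by (rule hom_comm_group) (use assms Dom_in_Obj Cod_in_Obj in auto)
  show "f \<boxplus> g \<in> Arr C" "Dom C (f \<boxplus> g) = Dom C g" "Cod C (f \<boxplus> g) = Cod C g"
    using G.m_closed[of f g] assms by (auto simp: hom_group_def Hom_def)
qed

lemma Add_Zero [simp]:
  assumes "f \<in> Arr C" "Dom C f = X" "Cod C f = Y"
  shows "f \<boxplus> Zero C X Y = f" "Zero C X Y \<boxplus> f = f"
proof -
  interpret G: comm_group "hom_group C X Y"
    by (rule hom_comm_group) (use assms Dom_in_Obj Cod_in_Obj in auto)
  show "f \<boxplus> Zero C X Y = f" "Zero C X Y \<boxplus> f = f"
    using G.r_one[of f] G.l_one[of f] assms by (auto simp: hom_group_def Hom_def)
qed

lemma Add_right_cancel: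
  assumes "f \<in> Hom C X Y" "g \<in> Hom C X Y" "h \<in> Hom C X Y" "f \<boxplus> h = g \<boxplus> h"
  shows "f = g"
proof -
  interpret G: comm_group "hom_group C X Y"
    by (rule hom_comm_group) (use assms HomD in auto)
  show ?thesis
    using G.right_cancel[of h f g] assms by (auto simp: hom_group_def)
qed

lemma ex_Add_inverse:
  assumes "f \<in> Hom C X Y"
  shows "\<exists>g\<in>Hom C X Y. f \<boxplus> g = Zero C X Y"
proof -
  interpret G: comm_group "hom_group C X Y"
    by (rule hom_comm_group) (use assms HomD in auto)
  show ?thesis
    using G.r_inv[of f] G.inv_closed[of f] assms by (auto simp: hom_group_def)
qed

text \<open>An idempotent of a group is neutral. Every law about zero arrows under composition and
  under additive functors is derived from this, because the axioms only provide
  distributivity.\<close>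

lemma Add_self_eq_ZeroD:
  assumes "f \<in> Hom C X Y" "f \<boxplus> f = f"
  shows "f = Zero C X Y"
proof -
  interpret G: comm_group "hom_group C X Y"
    by (rule hom_comm_group) (use assms HomD in auto)
  show ?thesis
    using G.l_cancel_one[of f f] assms by (simp add: hom_group_def)
qed

lemma Arr_Comp_Add:
  assumes "f \<in> Arr C" "f' \<in> Arr C" "g \<in> Arr C" "Dom C f = Dom C f'" "Cod C f = Cod C f'"
    and "Cod C f' = Dom C g"
  shows "g \<cdot> (f \<boxplus> f') = (g \<cdot> f) \<boxplus> (g \<cdot> f')"
  using Comp_Add[of f "Dom C f" "Cod C f" f' g "Cod C g"] assms by (auto simp: Hom_def)

lemma Arr_Add_Comp:
  assumes "f \<in> Arr C" "g \<in> Arr C" "g' \<in> Arr C" "Dom C g = Dom C g'" "Cod C g = Cod C g'"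
    and "Cod C f = Dom C g'"
  shows "(g \<boxplus> g') \<cdot> f = (g \<cdot> f) \<boxplus> (g' \<cdot> f)"
  using Add_Comp[of f "Dom C f" "Cod C f" g "Cod C g" g'] assms by (auto simp: Hom_def)

lemma Add_assoc:
  assumes "f \<in> Hom C X Y" "g \<in> Hom C X Y" "h \<in> Hom C X Y"
  shows "(f \<boxplus> g) \<boxplus> h = f \<boxplus> (g \<boxplus> h)"
proof -
  interpret G: comm_group "hom_group C X Y"
    by (rule hom_comm_group) (use assms HomD in auto)
  show ?thesis
    using G.m_assoc[of f g h] assms by (simp add: hom_group_def)
qed

lemma Add_commute:
  assumes "f \<in> Hom C X Y" "g \<in> Hom C X Y"
  shows "f \<boxplus> g = g \<boxplus> f"
proof -
  interpret G: comm_group "hom_group C X Y"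
    by (rule hom_comm_group) (use assms HomD in auto)
  show ?thesis
    using G.m_comm[of f g] assms by (simp add: hom_group_def)
qed

lemma Comp_Zero [simp]:
  assumes "g \<in> Arr C" "Dom C g = Y" "W \<in> Obj C"
  shows "g \<cdot> Zero C W Y = Zero C W (Cod C g)"
proof (rule Add_self_eq_ZeroD)
  have Y: "Y \<in> Obj C"
    using assms Dom_in_Obj by auto
  then show "g \<cdot> Zero C W Y \<in> Hom C W (Cod C g)"
    using assms by (simp add: Hom_def)
  show "g \<cdot> Zero C W Y \<boxplus> g \<cdot> Zero C W Y = g \<cdot> Zero C W Y"
    using Comp_Add[of "Zero C W Y" W Y "Zero C W Y" g "Cod C g"] assms Y by (simp add: Hom_def)
qed

lemma Zero_Comp [simp]:
  assumes "f \<in> Arr C" "Cod C f = Y" "Z \<in> Obj C"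
  shows "Zero C Y Z \<cdot> f = Zero C (Dom C f) Z"
proof (rule Add_self_eq_ZeroD)
  have Y: "Y \<in> Obj C"
    using assms Cod_in_Obj by auto
  then show "Zero C Y Z \<cdot> f \<in> Hom C (Dom C f) Z"
    using assms by (simp add: Hom_def)
  show "Zero C Y Z \<cdot> f \<boxplus> Zero C Y Z \<cdot> f = Zero C Y Z \<cdot> f"
    using Add_Comp[of f "Dom C f" Y "Zero C Y Z" Z "Zero C Y Z"] assms Y by (simp add: Hom_def)
qed

text \<open>Hom sets are groups: \<open>f \<cdot> g = f \<cdot> h\<close> says that \<open>f\<close>
  kills the difference of \<open>g\<close> and \<open>h\<close>, so it suffices to test arrows
  killed by \<open>f\<close>. The arrow \<open>h'\<close> below is minus \<open>h\<close>.\<close>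

lemma monoI:
  assumes "f \<in> Arr C"
    and "\<And>h. h \<in> Arr C \<Longrightarrow> Cod C h = Dom C f \<Longrightarrow> f \<cdot> h = Zero C (Dom C h) (Cod C f) \<Longrightarrow>
      h = Zero C (Dom C h) (Dom C f)"
  shows "is_mono C f"
  unfolding is_mono_def
proof (intro conjI allI ballI impI)
  fix W g h assume g: "g \<in> Hom C W (Dom C f)" and h: "h \<in> Hom C W (Dom C f)"
    and eq: "f \<cdot> g = f \<cdot> h"
  obtain h' where h': "h' \<in> Hom C W (Dom C f)" "h \<boxplus> h' = Zero C W (Dom C f)"
    using ex_Add_inverse[OF h] by blast
  have f: "f \<in> Hom C (Dom C f) (Cod C f)"
    using assms(1) by (simp add: Hom_def)
  have "f \<cdot> (g \<boxplus> h') = f \<cdot> (h \<boxplus> h')"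
    using Comp_Add[OF g h'(1) f] Comp_Add[OF h h'(1) f] eq by simp
  then have "g \<boxplus> h' = h \<boxplus> h'"
    using assms(2)[of "g \<boxplus> h'"] g h' HomD[OF h] f assms(1) by (simp add: Hom_def)
  then show "g = h"
    by (rule Add_right_cancel[OF g h h'(1)])
qed (rule assms)

lemma epiI:
  assumes "f \<in> Arr C"
    and "\<And>h. h \<in> Arr C \<Longrightarrow> Dom C h = Cod C f \<Longrightarrow> h \<cdot> f = Zero C (Dom C f) (Cod C h) \<Longrightarrow>
      h = Zero C (Cod C f) (Cod C h)"
  shows "is_epi C f"
  unfolding is_epi_def
proof (intro conjI allI ballI impI)
  fix W g h assume g: "g \<in> Hom C (Cod C f) W" and h: "h \<in> Hom C (Cod C f) W"
    and eq: "g \<cdot> f = h \<cdot> f"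
  obtain h' where h': "h' \<in> Hom C (Cod C f) W" "h \<boxplus> h' = Zero C (Cod C f) W"
    using ex_Add_inverse[OF h] by blast
  have f: "f \<in> Hom C (Dom C f) (Cod C f)"
    using assms(1) by (simp add: Hom_def)
  have "(g \<boxplus> h') \<cdot> f = (h \<boxplus> h') \<cdot> f"
    using Add_Comp[OF f g h'(1)] Add_Comp[OF f h h'(1)] eq by simp
  then have "g \<boxplus> h' = h \<boxplus> h'"
    using assms(2)[of "g \<boxplus> h'"] g h' HomD[OF h] f assms(1) by (simp add: Hom_def)
  then show "g = h"
    by (rule Add_right_cancel[OF g h h'(1)])
qed (rule assms)

text \<open>If \<open>k\<close> kills \<open>h\<close>, then \<open>h\<close> and the zero arrow
  both factor the zero arrow through \<open>k\<close>, and the universal property allows only one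
  such factorization.\<close>

lemma kernel_mono:
  assumes "is_kernel C k f"
  shows "is_mono C k"
proof (rule monoI)
  note k = kernelD[OF assms]
  show "k \<in> Arr C" by (rule k)
  fix h assume h: "h \<in> Arr C" "Cod C h = Dom C k" "k \<cdot> h = Zero C (Dom C h) (Cod C k)"
  have objs: "Dom C h \<in> Obj C" "Dom C k \<in> Obj C" "Dom C f \<in> Obj C" "Cod C f \<in> Obj C"
    using h k Dom_in_Obj Cod_in_Obj by auto
  have "\<exists>!u. u \<in> Hom C (Dom C h) (Dom C k) \<and> k \<cdot> u = Zero C (Dom C h) (Cod C k)"
  proof -
    have "Zero C (Dom C h) (Cod C k) \<in> Hom C (Dom C h) (Dom C f)"
      "f \<cdot> Zero C (Dom C h) (Cod C k) = Zero C (Dom C h) (Cod C f)"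
      using objs k by (auto simp: Hom_def)
    then show ?thesis
      using assms unfolding is_kernel_def by blast
  qed
  moreover have "h \<in> Hom C (Dom C h) (Dom C k)"
    "Zero C (Dom C h) (Dom C k) \<in> Hom C (Dom C h) (Dom C k)"
    "k \<cdot> Zero C (Dom C h) (Dom C k) = Zero C (Dom C h) (Cod C k)"
    using h k objs by (auto simp: Hom_def)
  ultimately show "h = Zero C (Dom C h) (Dom C k)"
    using h(3) by blast
qed

lemma cokernel_epi:
  assumes "is_cokernel C q f"
  shows "is_epi C q"
proof (rule epiI)
  note q = cokernelD[OF assms]
  show "q \<in> Arr C" by (rule q)
  fix h assume h: "h \<in> Arr C" "Dom C h = Cod C q" "h \<cdot> q = Zero C (Dom C q) (Cod C h)"
  have objs: "Cod C h \<in> Obj C" "Cod C q \<in> Obj C" "Dom C f \<in> Obj C" "Cod C f \<in> Obj C"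
    using h q Dom_in_Obj Cod_in_Obj by auto
  have "\<exists>!u. u \<in> Hom C (Cod C q) (Cod C h) \<and> u \<cdot> q = Zero C (Dom C q) (Cod C h)"
  proof -
    have "Zero C (Dom C q) (Cod C h) \<in> Hom C (Cod C f) (Cod C h)"
      "Zero C (Dom C q) (Cod C h) \<cdot> f = Zero C (Dom C f) (Cod C h)"
      using objs q by (auto simp: Hom_def)
    then show ?thesis
      using assms unfolding is_cokernel_def by blast
  qed
  moreover have "h \<in> Hom C (Cod C q) (Cod C h)"
    "Zero C (Cod C q) (Cod C h) \<in> Hom C (Cod C q) (Cod C h)"
    "Zero C (Cod C q) (Cod C h) \<cdot> q = Zero C (Dom C q) (Cod C h)"
    using h q objs by (auto simp: Hom_def)
  ultimately show "h = Zero C (Cod C q) (Cod C h)"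
    using h(3) by blast
qed

text \<open>As \<open>f\<close> kills \<open>k\<close>, it factors as \<open>v \<cdot> q\<close>;
  hence whatever \<open>q\<close> kills is also killed by \<open>f\<close> and factors through
  \<open>k\<close>.\<close>

lemma kernel_of_cokernel:
  assumes "is_kernel C k f" "is_cokernel C q k"
  shows "is_kernel C k q"
proof (rule kernelI)
  note k = kernelD[OF assms(1)] and q = cokernelD[OF assms(2)]
  show "q \<in> Arr C" "Cod C k = Dom C q" "q \<cdot> k = Zero C (Dom C k) (Cod C q)"
    using q by auto
  show "is_mono C k"
    by (rule kernel_mono[OF assms(1)])
  obtain v where v: "v \<in> Arr C" "Dom C v = Cod C q" "Cod C v = Cod C f" "v \<cdot> q = f"
    using cokernel_factor[OF assms(2), of f] k by auto
  fix h assume h: "h \<in> Arr C" "Cod C h = Dom C q" "q \<cdot> h = Zero C (Dom C h) (Cod C q)"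
  have "f \<cdot> h = v \<cdot> (q \<cdot> h)"
    using Arr_Comp_assoc[of h q v] h v q by auto
  also have "\<dots> = Zero C (Dom C h) (Cod C f)"
    using h v Dom_in_Obj by simp
  finally show "\<exists>u\<in>Arr C. Dom C u = Dom C h \<and> Cod C u = Dom C k \<and> k \<cdot> u = h"
    using kernel_factor[OF assms(1), of h] h k q by metis
qed

text \<open>Here \<open>f = k \<cdot> v\<close>, so an arrow that kills \<open>k\<close> also kills
  \<open>f\<close> and factors through \<open>q\<close>.\<close>

lemma cokernel_of_kernel:
  assumes "is_cokernel C q f" "is_kernel C k q"
  shows "is_cokernel C q k"
proof (rule cokernelI)
  note q = cokernelD[OF assms(1)] and k = kernelD[OF assms(2)]
  show "k \<in> Arr C" "Dom C q = Cod C k" "q \<cdot> k = Zero C (Dom C k) (Cod C q)"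
    using k by auto
  show "is_epi C q"
    by (rule cokernel_epi[OF assms(1)])
  obtain v where v: "v \<in> Arr C" "Dom C v = Dom C f" "Cod C v = Dom C k" "k \<cdot> v = f"
    using kernel_factor[OF assms(2), of f] q by auto
  fix h assume h: "h \<in> Arr C" "Dom C h = Cod C k" "h \<cdot> k = Zero C (Dom C k) (Cod C h)"
  have "h \<cdot> f = (h \<cdot> k) \<cdot> v"
    using Arr_Comp_assoc[of v k h] h v k by auto
  also have "\<dots> = Zero C (Dom C f) (Cod C h)"
    using h v Cod_in_Obj by simp
  finally show "\<exists>u\<in>Arr C. Dom C u = Cod C q \<and> Cod C u = Cod C h \<and> u \<cdot> q = h"
    using cokernel_factor[OF assms(1), of h] h k q by metis
qed

lemma zero_objectD:
  assumes "is_zero_object C N" "f \<in> Arr C" "g \<in> Arr C" "Dom C f = Dom C g" "Cod C f = Cod C g"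
    and "Dom C g = N \<or> Cod C g = N"
  shows "f = g"
proof -
  have mem: "f \<in> Hom C (Dom C g) (Cod C g)" "g \<in> Hom C (Dom C g) (Cod C g)"
    using assms by (auto simp: Hom_def)
  have "\<exists>!e. e \<in> Hom C (Dom C g) (Cod C g)"
    using assms(1,6) HomD(4,5)[OF mem(2)] unfolding is_zero_object_def by metis
  then show ?thesis
    using mem by blast
qed

text \<open>Supplies the image needed for exactness at the last term of a right exact sequence:
  there both the cokernel of the epimorphism and the next map are zero arrows.\<close>

lemma Id_kernel_of_Zero:
  assumes "X \<in> Obj C" "Y \<in> Obj C"
  shows "is_kernel C (Id C X) (Zero C X Y)"
proof (rule kernelI)
  show "is_mono C (Id C X)"
    using assms by (intro monoI) auto
  fix h assume "h \<in> Arr C" "Cod C h = Dom C (Zero C X Y)"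
  then show "\<exists>u\<in>Arr C. Dom C u = Dom C h \<and> Cod C u = Dom C (Id C X) \<and> Id C X \<cdot> u = h"
    using assms by (intro bexI[of _ h]) auto
qed (use assms in auto)

lemma epi_iff_Zero_cokernel:
  assumes "is_zero_object C N" "f \<in> Arr C"
  shows "is_epi C f \<longleftrightarrow> is_cokernel C (Zero C (Cod C f) N) f"
proof
  note [simp] = Dom_in_Obj Cod_in_Obj
  have N: "N \<in> Obj C"
    using assms(1) by (simp add: is_zero_object_def)
  show "is_cokernel C (Zero C (Cod C f) N) f" if f: "is_epi C f"
  proof (rule cokernelI)
    show "is_epi C (Zero C (Cod C f) N)"
    proof (rule epiI)
      fix h assume "h \<in> Arr C" "Dom C h = Cod C (Zero C (Cod C f) N)"
      then show "h = Zero C (Cod C (Zero C (Cod C f) N)) (Cod C h)"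
        using N assms(2) by (intro zero_objectD[OF assms(1)]) auto
    qed (use N assms(2) in auto)
    fix h assume h: "h \<in> Arr C" "Dom C h = Cod C f" "h \<cdot> f = Zero C (Dom C f) (Cod C h)"
    have "h = Zero C (Cod C f) (Cod C h)"
      by (rule epiD[OF f]) (use h assms(2) in auto)
    then show "\<exists>u\<in>Arr C. Dom C u = Cod C (Zero C (Cod C f) N) \<and> Cod C u = Cod C h \<and>
        u \<cdot> Zero C (Cod C f) N = h"
      using N h assms by (intro bexI[of _ "Zero C N (Cod C h)"]) auto
  qed (use N assms in auto)
  show "is_epi C f" if q: "is_cokernel C (Zero C (Cod C f) N) f"
  proof (rule epiI[OF assms(2)])
    fix h assume h: "h \<in> Arr C" "Dom C h = Cod C f" "h \<cdot> f = Zero C (Dom C f) (Cod C h)"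
    obtain u where u: "u \<in> Arr C" "Dom C u = N" "Cod C u = Cod C h" "u \<cdot> Zero C (Cod C f) N = h"
      using cokernel_factor[OF q h] N assms(2) by auto
    then show "h = Zero C (Cod C f) (Cod C h)"
      using assms(2) by auto
  qed
qed

end

section \<open>Normality with explicit witnesses, and right exactness in terms of cokernels\<close>

context abelian_category
begin

text \<open>The axiom yields some \<open>g\<close> without any control over it. Replacing it by a
  chosen cokernel of \<open>f\<close> gives a witness that can later be lifted to the
  extension.\<close>

lemma mono_kernel_of_cokernel:
  assumes "is_mono C f" "is_cokernel C q f"
  shows "is_kernel C f q"
proof -
  obtain g where "is_kernel C f g"
    using mono_is_kernel[OF assms(1)] ..
  then show ?thesis
    by (rule kernel_of_cokernel[OF _ assms(2)])
qed

lemma epi_cokernel_of_kernel: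
  assumes "is_epi C f" "is_kernel C k f"
  shows "is_cokernel C f k"
proof -
  obtain g where "is_cokernel C f g"
    using epi_is_cokernel[OF assms(1)] ..
  then show ?thesis
    by (rule cokernel_of_kernel[OF _ assms(2)])
qed

text \<open>Bridge between the definition of right exactness by exact sequences and its later use as
  preservation of cokernels. In the harder direction, exactness at the end makes \<open>g\<close> an
  epimorphism, and then \<open>g\<close> and a cokernel of \<open>f\<close> have a common
  kernel.\<close>

lemma right_exact_sequence_iff_cokernel: "right_exact_sequence C f g \<longleftrightarrow> is_cokernel C g f"
proof
  note [simp] = Dom_in_Obj Cod_in_Obj
  assume g: "is_cokernel C g f"
  obtain N where N: "is_zero_object C N"
    using ex_zero_object by blast
  then have N': "N \<in> Obj C"
    by (simp add: is_zero_object_def)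
  \<comment> \<open>The cokernel required by \<open>exact_at\<close> can be \<open>g\<close> itself,
    so any kernel of \<open>g\<close> serves as image.\<close>
  have "\<exists>m. is_kernel C m g"
    using ex_kernel cokernelD[OF g] by blast
  then have "exact_at C f g"
    using g cokernelD[OF g] by (auto simp: exact_at_def)
  moreover have "is_cokernel C (Zero C (Cod C g) N) g"
    using epi_iff_Zero_cokernel[OF N, of g] cokernel_epi[OF g] cokernelD[OF g] by simp
  then have "exact_at C g (Zero C (Cod C g) N)"
    using Id_kernel_of_Zero[of "Cod C g" N] N' cokernelD[OF g] unfolding exact_at_def by auto
  ultimately show "right_exact_sequence C f g"
    using N by (auto simp: right_exact_sequence_def)
next
  note [simp] = Dom_in_Obj Cod_in_Obj
  assume "right_exact_sequence C f g"
  then obtain q m N c m' where q: "is_cokernel C q f" "is_kernel C m q" and m: "is_kernel C m g"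
    and N: "is_zero_object C N" and c: "is_cokernel C c g" "is_kernel C m' c"
    and m': "is_kernel C m' (Zero C (Cod C g) N)"
    unfolding right_exact_sequence_def exact_at_def by blast
  have N': "N \<in> Obj C"
    using N by (simp add: is_zero_object_def)
  note qD = cokernelD[OF q(1)] and mD = kernelD[OF m] and cD = cokernelD[OF c(1)]
    and mqD = kernelD[OF q(2)] and m'D = kernelD[OF m'] and m'cD = kernelD[OF c(2)]
  \<comment> \<open>The identity is killed by the zero arrow and therefore factors through its
    kernel \<open>m'\<close>. Since \<open>c\<close> kills \<open>m'\<close>, it follows that
    \<open>c\<close> is zero.\<close>
  obtain u where u: "u \<in> Arr C" "Dom C u = Cod C g" "Cod C u = Dom C m'"
      "m' \<cdot> u = Id C (Cod C g)"
    using kernel_factor[OF m', of "Id C (Cod C g)"] mD N' by auto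
  have "c = (c \<cdot> m') \<cdot> u"
    using Arr_Comp_assoc[of u m' c] u m'D m'cD cD mD by auto
  then have c0: "c = Zero C (Cod C g) (Cod C c)"
    using m'cD u cD by simp
  \<comment> \<open>An arrow that kills \<open>g\<close> factors through the cokernel
    \<open>c\<close>, which is zero.\<close>
  have epi: "is_epi C g"
  proof (rule epiI)
    show "g \<in> Arr C" by (rule mD)
    fix h assume h: "h \<in> Arr C" "Dom C h = Cod C g" "h \<cdot> g = Zero C (Dom C g) (Cod C h)"
    obtain v where "v \<in> Arr C" "Dom C v = Cod C c" "Cod C v = Cod C h" "v \<cdot> c = h"
      using cokernel_factor[OF c(1) h] by auto
    then show "h = Zero C (Cod C g) (Cod C h)"
      using c0 mD by (metis Comp_Zero Cod_in_Obj)
  qed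
  \<comment> \<open>Both \<open>g\<close> and \<open>q\<close> are cokernels of the common kernel
    \<open>m\<close>. An arrow killing \<open>f\<close> factors through \<open>q\<close>, hence
    kills \<open>m\<close>, hence factors through \<open>g\<close>.\<close>
  have gm: "is_cokernel C g m"
    by (rule epi_cokernel_of_kernel[OF epi m])
  have qm: "is_cokernel C q m"
    by (rule cokernel_of_kernel[OF q])
  obtain w where w: "w \<in> Arr C" "Cod C w = Dom C m" "Dom C w = Dom C f" "m \<cdot> w = f"
    using kernel_factor[OF q(2), of f] qD by auto
  show "is_cokernel C g f"
  proof (rule cokernelI[OF _ epi])
    show "f \<in> Arr C" "Dom C g = Cod C f"
      using qD mD mqD by auto
    have "g \<cdot> f = (g \<cdot> m) \<cdot> w"
      using Arr_Comp_assoc[of w m g] w mD by auto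
    then show "g \<cdot> f = Zero C (Dom C f) (Cod C g)"
      using w mD by simp
    fix h assume h: "h \<in> Arr C" "Dom C h = Cod C f" "h \<cdot> f = Zero C (Dom C f) (Cod C h)"
    obtain v where v: "v \<in> Arr C" "Dom C v = Cod C q" "Cod C v = Cod C h" "v \<cdot> q = h"
      using cokernel_factor[OF q(1) h] by auto
    have "h \<cdot> m = v \<cdot> (q \<cdot> m)"
      using Arr_Comp_assoc[of m q v] v mqD by auto
    then have "h \<cdot> m = Zero C (Dom C m) (Cod C h)"
      using v mqD by simp
    then show "\<exists>u\<in>Arr C. Dom C u = Cod C g \<and> Cod C u = Cod C h \<and> u \<cdot> g = h"
      using cokernel_factor[OF gm, of h] h qD mqD mD by metis
  qed
qed

end

lemma right_exact_cokernel:
  assumes "abelian_category A" "abelian_category B" "right_exact A B F" "is_cokernel A q f"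
  shows "is_cokernel B (onArr F q) (onArr F f)"
proof -
  interpret A: abelian_category A by (rule assms(1))
  interpret B: abelian_category B by (rule assms(2))
  show ?thesis
    using assms(3,4)
    by (simp add: right_exact_def A.right_exact_sequence_iff_cokernel B.right_exact_sequence_iff_cokernel)
qed

section \<open>Modules over a family of right exact functors\<close>

locale right_exact_family = abelian_category A for A :: "('o, 'm) cat" (structure) +
  fixes n :: nat
    and F :: "nat \<Rightarrow> ('o, 'm, 'o, 'm) cat_fun"
    and \<Phi> :: "nat \<Rightarrow> nat \<Rightarrow> 'o \<Rightarrow> 'm"
  assumes additive: "i \<in> {1..n} \<Longrightarrow> additive_functor A A (F i)"
    and natural: "natural_family A n F \<Phi>"
    and right_exact: "i \<in> {1..n} \<Longrightarrow> right_exact A A (F i)"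
begin

section \<open>The functors and the natural transformations on arrows\<close>

lemma fun_Obj [simp]: "i \<in> {1..n} \<Longrightarrow> X \<in> Obj A \<Longrightarrow> onObj (F i) X \<in> Obj A"
  by (rule covariant_functor.onObj_in_Obj[OF additive_functor.axioms(1)[OF additive]])

lemma fun_Arr [simp]:
  assumes "i \<in> {1..n}" "f \<in> Arr A"
  shows "onArr (F i) f \<in> Arr A" "Dom A (onArr (F i) f) = onObj (F i) (Dom A f)"
    "Cod A (onArr (F i) f) = onObj (F i) (Cod A f)"
proof -
  interpret additive_functor A A "F i"
    by (rule additive[OF assms(1)])
  show "onArr (F i) f \<in> Arr A" "Dom A (onArr (F i) f) = onObj (F i) (Dom A f)"
    "Cod A (onArr (F i) f) = onObj (F i) (Cod A f)"
    using onArr_in_Hom[of f "Dom A f" "Cod A f"] assms(2) by (auto simp: Hom_def)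
qed

lemma fun_Id [simp]: "i \<in> {1..n} \<Longrightarrow> X \<in> Obj A \<Longrightarrow> onArr (F i) (Id A X) = Id A (onObj (F i) X)"
  by (rule covariant_functor.onArr_Id[OF additive_functor.axioms(1)[OF additive]])

lemma fun_Comp:
  assumes "i \<in> {1..n}" "f \<in> Arr A" "g \<in> Arr A" "Cod A f = Dom A g"
  shows "onArr (F i) (g \<cdot> f) = onArr (F i) g \<cdot> onArr (F i) f"
proof -
  interpret additive_functor A A "F i"
    by (rule additive[OF assms(1)])
  show ?thesis
    using onArr_Comp[of f "Dom A f" "Cod A f" g "Cod A g"] assms by (auto simp: Hom_def)
qed

lemma fun_Add:
  assumes "i \<in> {1..n}" "f \<in> Arr A" "g \<in> Arr A" "Dom A f = Dom A g" "Cod A f = Cod A g"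
  shows "onArr (F i) (f \<boxplus> g) = onArr (F i) f \<boxplus> onArr (F i) g"
proof -
  interpret additive_functor A A "F i"
    by (rule additive[OF assms(1)])
  show ?thesis
    using onArr_Add[of f "Dom A f" "Cod A f" g] assms by (auto simp: Hom_def)
qed

lemma fun_Zero [simp]:
  assumes "i \<in> {1..n}" "X \<in> Obj A" "Y \<in> Obj A"
  shows "onArr (F i) (Zero A X Y) = Zero A (onObj (F i) X) (onObj (F i) Y)"
proof (rule Add_self_eq_ZeroD)
  show "onArr (F i) (Zero A X Y) \<in> Hom A (onObj (F i) X) (onObj (F i) Y)"
    using assms by (simp add: Hom_def)
  show "onArr (F i) (Zero A X Y) \<boxplus> onArr (F i) (Zero A X Y) = onArr (F i) (Zero A X Y)"
    using fun_Add[OF assms(1), of "Zero A X Y" "Zero A X Y"] assms by simp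
qed

lemma fun_cokernel:
  assumes "i \<in> {1..n}" "is_cokernel A q f"
  shows "is_cokernel A (onArr (F i) q) (onArr (F i) f)"
  by (rule right_exact_cokernel[OF abelian_category_axioms abelian_category_axioms
        right_exact[OF assms(1)] assms(2)])

lemma Phi_natural_transformation:
  assumes "i \<in> {1..n}" "j \<in> {1..n}" "i + j \<le> n"
  shows "natural_transformation A A (comp_cat_fun (F i) (F j)) (F (i + j)) (\<Phi> i j)"
  using natural assms by (auto simp: natural_family_def)

lemma Phi_Arr [simp]:
  assumes "i \<in> {1..n}" "j \<in> {1..n}" "i + j \<le> n" "X \<in> Obj A"
  shows "\<Phi> i j X \<in> Arr A" "Dom A (\<Phi> i j X) = onObj (F i) (onObj (F j) X)"
    "Cod A (\<Phi> i j X) = onObj (F (i + j)) X"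
  using natural_transformation.component_in_Hom[OF Phi_natural_transformation[OF assms(1-3)] assms(4)]
  by (auto simp: Hom_def comp_cat_fun_def)

lemma Phi_natural:
  assumes "i \<in> {1..n}" "j \<in> {1..n}" "i + j \<le> n" "f \<in> Arr A"
  shows "\<Phi> i j (Cod A f) \<cdot> onArr (F i) (onArr (F j) f) = onArr (F (i + j)) f \<cdot> \<Phi> i j (Dom A f)"
  using natural_transformation.naturality[OF Phi_natural_transformation[OF assms(1-3)],
      of f "Dom A f" "Cod A f"] assms(4)
  by (simp add: Hom_def comp_cat_fun_def)

text \<open>Typing of the family without the defining relations, so that naturality can be applied
  to a candidate structure whose relations are still to be proved. Values outside
  \<open>{1..n}\<close> are left free here; they are fixed only for objects of the
  extension.\<close>

definition actions :: "'o \<times> (nat \<Rightarrow> 'm) \<Rightarrow> bool"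
  where "actions P \<longleftrightarrow> fst P \<in> Obj A \<and>
    (\<forall>i\<in>{1..n}. snd P i \<in> Arr A \<and> Dom A (snd P i) = onObj (F i) (fst P) \<and> Cod A (snd P i) = fst P)"

text \<open>The value that the defining relations prescribe for \<open>f\<^sub>i \<circ> F\<^sub>i(f\<^sub>j)\<close>.\<close>

definition composite_action :: "'o \<times> (nat \<Rightarrow> 'm) \<Rightarrow> nat \<Rightarrow> nat \<Rightarrow> 'm"
  where "composite_action P i j = (if i + j \<le> n then snd P (i + j) \<cdot> \<Phi> i j (fst P)
    else Zero A (onObj (F i) (onObj (F j) (fst P))) (fst P))"

definition is_module :: "'o \<times> (nat \<Rightarrow> 'm) \<Rightarrow> bool"
  where "is_module P \<longleftrightarrow> actions P \<and>
    (\<forall>i\<in>{1..n}. \<forall>j\<in>{1..n}. snd P i \<cdot> onArr (F i) (snd P j) = composite_action P i j)"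

definition equivariant :: "'o \<times> (nat \<Rightarrow> 'm) \<Rightarrow> 'o \<times> (nat \<Rightarrow> 'm) \<Rightarrow> 'm \<Rightarrow> bool"
  where "equivariant P Q \<gamma> \<longleftrightarrow> \<gamma> \<in> Arr A \<and> Dom A \<gamma> = fst P \<and> Cod A \<gamma> = fst Q \<and>
    (\<forall>i\<in>{1..n}. \<gamma> \<cdot> snd P i = snd Q i \<cdot> onArr (F i) \<gamma>)"

lemma actionsD:
  assumes "actions P"
  shows "fst P \<in> Obj A" "i \<in> {1..n} \<Longrightarrow> snd P i \<in> Arr A"
    "i \<in> {1..n} \<Longrightarrow> Dom A (snd P i) = onObj (F i) (fst P)"
    "i \<in> {1..n} \<Longrightarrow> Cod A (snd P i) = fst P"
  using assms unfolding actions_def by blast+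

lemma moduleD:
  assumes "is_module P"
  shows "actions P"
    "i \<in> {1..n} \<Longrightarrow> j \<in> {1..n} \<Longrightarrow> snd P i \<cdot> onArr (F i) (snd P j) = composite_action P i j"
  using assms unfolding is_module_def by blast+

lemma equivariantD:
  assumes "equivariant P Q \<gamma>"
  shows "\<gamma> \<in> Arr A" "Dom A \<gamma> = fst P" "Cod A \<gamma> = fst Q"
    "i \<in> {1..n} \<Longrightarrow> \<gamma> \<cdot> snd P i = snd Q i \<cdot> onArr (F i) \<gamma>"
  using assms unfolding equivariant_def by blast+

section \<open>Transport of the defining relations along equivariant arrows\<close>

lemma composite_action_Arr [simp]:
  assumes "actions P" "i \<in> {1..n}" "j \<in> {1..n}"
  shows "composite_action P i j \<in> Arr A"
    "Dom A (composite_action P i j) = onObj (F i) (onObj (F j) (fst P))"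
    "Cod A (composite_action P i j) = fst P"
  using assms actionsD[OF assms(1)] unfolding composite_action_def by auto

text \<open>Below the bound this combines equivariance in degree \<open>i + j\<close> with
  naturality of \<open>\<Phi> i j\<close>; above it both sides are zero arrows. Together with
  \<open>iterated_action_natural\<close> it lets either side of a defining relation pass along an
  equivariant arrow.\<close>

lemma composite_action_natural:
  assumes P: "actions P" and Q: "actions Q" and \<gamma>: "equivariant P Q \<gamma>"
    and i: "i \<in> {1..n}" and j: "j \<in> {1..n}"
  shows "\<gamma> \<cdot> composite_action P i j = composite_action Q i j \<cdot> onArr (F i) (onArr (F j) \<gamma>)"
proof (cases "i + j \<le> n")
  case True
  then have ij: "i + j \<in> {1..n}"
    using i by auto
  note D = actionsD[OF P] actionsD[OF Q] equivariantD[OF \<gamma>]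
  have "\<gamma> \<cdot> composite_action P i j = \<gamma> \<cdot> (snd P (i + j) \<cdot> \<Phi> i j (fst P))"
    using True by (simp add: composite_action_def)
  also have "\<dots> = (\<gamma> \<cdot> snd P (i + j)) \<cdot> \<Phi> i j (fst P)"
    by (rule Arr_Comp_assoc[symmetric]) (use D i j ij True in simp_all)
  also have "\<dots> = (snd Q (i + j) \<cdot> onArr (F (i + j)) \<gamma>) \<cdot> \<Phi> i j (fst P)"
    using D(12)[OF ij] by simp
  also have "\<dots> = snd Q (i + j) \<cdot> (onArr (F (i + j)) \<gamma> \<cdot> \<Phi> i j (fst P))"
    by (rule Arr_Comp_assoc) (use D i j ij True in simp_all)
  also have "\<dots> = snd Q (i + j) \<cdot> (\<Phi> i j (fst Q) \<cdot> onArr (F i) (onArr (F j) \<gamma>))"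
    using Phi_natural[OF i j True D(9)] D by simp
  also have "\<dots> = (snd Q (i + j) \<cdot> \<Phi> i j (fst Q)) \<cdot> onArr (F i) (onArr (F j) \<gamma>)"
    by (rule Arr_Comp_assoc[symmetric]) (use D i j ij True in simp_all)
  finally show ?thesis
    using True by (simp add: composite_action_def)
next
  case False
  then show ?thesis
    using actionsD[OF P] actionsD[OF Q] equivariantD[OF \<gamma>] i j by (simp add: composite_action_def)
qed

text \<open>Equivariance is used twice, once outside and once under \<open>F i\<close>.\<close>

lemma iterated_action_natural:
  assumes P: "actions P" and Q: "actions Q" and \<gamma>: "equivariant P Q \<gamma>"
    and i: "i \<in> {1..n}" and j: "j \<in> {1..n}"
  shows "\<gamma> \<cdot> (snd P i \<cdot> onArr (F i) (snd P j)) =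
    (snd Q i \<cdot> onArr (F i) (snd Q j)) \<cdot> onArr (F i) (onArr (F j) \<gamma>)"
proof -
  note D = actionsD[OF P] actionsD[OF Q] equivariantD[OF \<gamma>]
  have "\<gamma> \<cdot> (snd P i \<cdot> onArr (F i) (snd P j)) = (\<gamma> \<cdot> snd P i) \<cdot> onArr (F i) (snd P j)"
    by (rule Arr_Comp_assoc[symmetric]) (use D i j in simp_all)
  also have "\<dots> = (snd Q i \<cdot> onArr (F i) \<gamma>) \<cdot> onArr (F i) (snd P j)"
    using D(12)[OF i] by simp
  also have "\<dots> = snd Q i \<cdot> (onArr (F i) \<gamma> \<cdot> onArr (F i) (snd P j))"
    by (rule Arr_Comp_assoc) (use D i j in simp_all)
  also have "onArr (F i) \<gamma> \<cdot> onArr (F i) (snd P j) = onArr (F i) (\<gamma> \<cdot> snd P j)"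
    by (rule fun_Comp[symmetric]) (use D i j in simp_all)
  also have "\<dots> = onArr (F i) (snd Q j \<cdot> onArr (F j) \<gamma>)"
    using D(12)[OF j] by simp
  also have "\<dots> = onArr (F i) (snd Q j) \<cdot> onArr (F i) (onArr (F j) \<gamma>)"
    by (rule fun_Comp) (use D i j in simp_all)
  also have "snd Q i \<cdot> \<dots> = (snd Q i \<cdot> onArr (F i) (snd Q j)) \<cdot> onArr (F i) (onArr (F j) \<gamma>)"
    by (rule Arr_Comp_assoc[symmetric]) (use D i j in simp_all)
  finally show ?thesis .
qed

text \<open>After composition with any \<open>p\<close> in the family, the relation for
  \<open>S\<close> turns into the one for the target of \<open>p\<close>. Allowing a jointly monic
  set instead of one monomorphism covers kernels (one inclusion) and biproducts (two projections)
  alike.\<close>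

lemma is_module_lift:
  assumes S: "actions S"
    and jointly_monic: "\<And>f g. f \<in> Arr A \<Longrightarrow> g \<in> Arr A \<Longrightarrow> Dom A f = Dom A g \<Longrightarrow>
      Cod A f = fst S \<Longrightarrow> Cod A g = fst S \<Longrightarrow> (\<And>Q p. (Q, p) \<in> \<P> \<Longrightarrow> p \<cdot> f = p \<cdot> g) \<Longrightarrow> f = g"
    and \<P>: "\<And>Q p. (Q, p) \<in> \<P> \<Longrightarrow> is_module Q \<and> equivariant S Q p"
  shows "is_module S"
  unfolding is_module_def
proof (intro conjI ballI S)
  fix i j assume i: "i \<in> {1..n}" and j: "j \<in> {1..n}"
  show "snd S i \<cdot> onArr (F i) (snd S j) = composite_action S i j"
  proof (rule jointly_monic)
    fix Q p assume "(Q, p) \<in> \<P>"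
    then have Q: "is_module Q" and p: "equivariant S Q p"
      using \<P> by auto
    show "p \<cdot> (snd S i \<cdot> onArr (F i) (snd S j)) = p \<cdot> composite_action S i j"
      using iterated_action_natural[OF S moduleD(1)[OF Q] p i j]
        composite_action_natural[OF S moduleD(1)[OF Q] p i j] moduleD(2)[OF Q i j] by simp
  qed (use actionsD[OF S] S i j in simp_all)
qed

text \<open>The hypothesis on \<open>q\<close> is phrased with a cokernel because this is what
  \<open>fun_cokernel\<close> carries through \<open>F j\<close> and then \<open>F i\<close>; the
  resulting epimorphism is cancelled on the right of the relation.\<close>

lemma is_module_descend:
  assumes P: "is_module P" and Q: "actions Q" and q: "equivariant P Q q"
    and coker: "is_cokernel A q f"
  shows "is_module Q"
  unfolding is_module_def
proof (intro conjI ballI Q)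
  fix i j assume i: "i \<in> {1..n}" and j: "j \<in> {1..n}"
  have epi: "is_epi A (onArr (F i) (onArr (F j) q))"
    by (rule cokernel_epi[OF fun_cokernel[OF i fun_cokernel[OF j coker]]])
  show "snd Q i \<cdot> onArr (F i) (snd Q j) = composite_action Q i j"
  proof (rule epiD[OF epi])
    show "(snd Q i \<cdot> onArr (F i) (snd Q j)) \<cdot> onArr (F i) (onArr (F j) q) =
        composite_action Q i j \<cdot> onArr (F i) (onArr (F j) q)"
      using iterated_action_natural[OF moduleD(1)[OF P] Q q i j]
        composite_action_natural[OF moduleD(1)[OF P] Q q i j] moduleD(2)[OF P i j] by simp
  qed (use actionsD[OF Q] equivariantD[OF q] Q i j in simp_all)
qed

section \<open>The extension is abelian\<close>

abbreviation "E \<equiv> right_trivial_extension A n F \<Phi>"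

lemma extension_simps [simp]:
  "Dom E (P, \<gamma>, Q) = P" "Cod E (P, \<gamma>, Q) = Q"
  "Id E P = (P, Id A (fst P), P)" "Zero E P Q = (P, Zero A (fst P) (fst Q), Q)"
  "Comp E (Q', \<delta>, R) (P, \<gamma>, Q) = (P, \<delta> \<cdot> \<gamma>, R)"
  "Add E (P, \<gamma>, Q) (P', \<gamma>', Q') = (P, \<gamma> \<boxplus> \<gamma>', Q)"
  by (simp_all add: right_trivial_extension_def)

text \<open>Isolates the encoding from the mathematics: an object is a module whose family is
  extensional. This is why every action constructed below is cut down to \<open>{1..n}\<close> by
  \<open>restrict\<close>.\<close>

lemma Obj_extension: "P \<in> Obj E \<longleftrightarrow> is_module P \<and> snd P \<in> extensional {1..n}"
  unfolding right_trivial_extension_def rext_obj_def is_module_def actions_def composite_action_def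
  by (cases P) (auto simp: PiE_def Pi_def Hom_def)

lemma Arr_extension:
  "(P, \<gamma>, Q) \<in> Arr E \<longleftrightarrow> P \<in> Obj E \<and> Q \<in> Obj E \<and> equivariant P Q \<gamma>"
  unfolding right_trivial_extension_def equivariant_def
  by (cases P; cases Q) (auto simp: Hom_def)

lemma Arr_extensionE:
  assumes "x \<in> Arr E"
  obtains P \<gamma> Q where "x = (P, \<gamma>, Q)" "P \<in> Obj E" "Q \<in> Obj E" "equivariant P Q \<gamma>"
proof -
  obtain P \<gamma> Q where "x = (P, \<gamma>, Q)"
    by (cases x) auto
  then show thesis
    using that assms by (simp add: Arr_extension)
qed

lemma Hom_extension:
  "x \<in> Hom E P Q \<longleftrightarrow> (\<exists>\<gamma>. x = (P, \<gamma>, Q) \<and> P \<in> Obj E \<and> Q \<in> Obj E \<and> equivariant P Q \<gamma>)"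
  unfolding Hom_def by (cases x) (auto simp: Arr_extension)

lemma ObjD:
  assumes "P \<in> Obj E"
  shows "is_module P" "actions P" "fst P \<in> Obj A"
  using assms moduleD(1) actionsD(1) by (auto simp: Obj_extension)

section \<open>The preadditive structure of the extension\<close>

lemma equivariant_Id: "actions P \<Longrightarrow> equivariant P P (Id A (fst P))"
  using actionsD[of P] by (simp add: equivariant_def)

lemma equivariant_Zero: "actions P \<Longrightarrow> actions Q \<Longrightarrow> equivariant P Q (Zero A (fst P) (fst Q))"
  using actionsD[of P] actionsD[of Q] by (simp add: equivariant_def)

lemma equivariant_Comp:
  assumes "actions P" "actions Q" "actions R" "equivariant P Q \<gamma>" "equivariant Q R \<delta>"
  shows "equivariant P R (\<delta> \<cdot> \<gamma>)"
  unfolding equivariant_def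
proof (intro conjI ballI)
  note D = actionsD[OF assms(1)] actionsD[OF assms(2)] actionsD[OF assms(3)]
    equivariantD[OF assms(4)] equivariantD[OF assms(5)]
  show "\<delta> \<cdot> \<gamma> \<in> Arr A" "Dom A (\<delta> \<cdot> \<gamma>) = fst P" "Cod A (\<delta> \<cdot> \<gamma>) = fst R"
    using D by simp_all
  fix i assume i: "i \<in> {1..n}"
  have "(\<delta> \<cdot> \<gamma>) \<cdot> snd P i = \<delta> \<cdot> (\<gamma> \<cdot> snd P i)"
    by (rule Arr_Comp_assoc) (use D i in simp_all)
  also have "\<dots> = \<delta> \<cdot> (snd Q i \<cdot> onArr (F i) \<gamma>)"
    using equivariantD(4)[OF assms(4) i] by simp
  also have "\<dots> = (\<delta> \<cdot> snd Q i) \<cdot> onArr (F i) \<gamma>"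
    by (rule Arr_Comp_assoc[symmetric]) (use D i in simp_all)
  also have "\<dots> = (snd R i \<cdot> onArr (F i) \<delta>) \<cdot> onArr (F i) \<gamma>"
    using equivariantD(4)[OF assms(5) i] by simp
  also have "\<dots> = snd R i \<cdot> (onArr (F i) \<delta> \<cdot> onArr (F i) \<gamma>)"
    by (rule Arr_Comp_assoc) (use D i in simp_all)
  also have "onArr (F i) \<delta> \<cdot> onArr (F i) \<gamma> = onArr (F i) (\<delta> \<cdot> \<gamma>)"
    by (rule fun_Comp[symmetric]) (use D i in simp_all)
  finally show "(\<delta> \<cdot> \<gamma>) \<cdot> snd P i = snd R i \<cdot> onArr (F i) (\<delta> \<cdot> \<gamma>)" .
qed

text \<open>Additivity of \<open>F i\<close> splits the right-hand side, bilinearity of composition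
  the left-hand side.\<close>

lemma equivariant_Add:
  assumes "actions P" "actions Q" "equivariant P Q \<gamma>" "equivariant P Q \<delta>"
  shows "equivariant P Q (\<gamma> \<boxplus> \<delta>)"
  unfolding equivariant_def
proof (intro conjI ballI)
  note D = actionsD[OF assms(1)] actionsD[OF assms(2)]
    equivariantD[OF assms(3)] equivariantD[OF assms(4)]
  show "\<gamma> \<boxplus> \<delta> \<in> Arr A" "Dom A (\<gamma> \<boxplus> \<delta>) = fst P" "Cod A (\<gamma> \<boxplus> \<delta>) = fst Q"
    using D by simp_all
  fix i assume i: "i \<in> {1..n}"
  show "(\<gamma> \<boxplus> \<delta>) \<cdot> snd P i = snd Q i \<cdot> onArr (F i) (\<gamma> \<boxplus> \<delta>)"
    using D i by (simp add: Arr_Add_Comp fun_Add Arr_Comp_Add)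
qed

text \<open>Adding \<open>\<gamma> \<cdot> snd P i\<close> to both sides of the equation wanted for
  \<open>\<delta>\<close> reduces it to equivariance of the zero arrow, so the summand can be
  cancelled.\<close>

lemma equivariant_inverse:
  assumes "actions P" "actions Q" "equivariant P Q \<gamma>"
  shows "\<exists>\<delta>. equivariant P Q \<delta> \<and> \<delta> \<boxplus> \<gamma> = Zero A (fst P) (fst Q)"
proof -
  note D = actionsD[OF assms(1)] actionsD[OF assms(2)] equivariantD[OF assms(3)]
  have \<gamma>: "\<gamma> \<in> Hom A (fst P) (fst Q)"
    using D by (simp add: Hom_def)
  obtain \<delta> where \<delta>: "\<delta> \<in> Hom A (fst P) (fst Q)" "\<gamma> \<boxplus> \<delta> = Zero A (fst P) (fst Q)"
    using ex_Add_inverse[OF \<gamma>] by blast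
  note H = HomD[OF \<delta>(1)]
  \<comment> \<open>\<open>comm_groupI\<close> asks for a left inverse.\<close>
  have inv: "\<delta> \<boxplus> \<gamma> = Zero A (fst P) (fst Q)"
    using Add_commute[OF \<gamma> \<delta>(1)] \<delta>(2) by simp
  have "\<delta> \<cdot> snd P i = snd Q i \<cdot> onArr (F i) \<delta>" if i: "i \<in> {1..n}" for i
  proof (rule Add_right_cancel)
    show "\<delta> \<cdot> snd P i \<in> Hom A (onObj (F i) (fst P)) (fst Q)"
      "snd Q i \<cdot> onArr (F i) \<delta> \<in> Hom A (onObj (F i) (fst P)) (fst Q)"
      "\<gamma> \<cdot> snd P i \<in> Hom A (onObj (F i) (fst P)) (fst Q)"
      using D H i by (simp_all add: Hom_def)
    have "\<delta> \<cdot> snd P i \<boxplus> \<gamma> \<cdot> snd P i = (\<delta> \<boxplus> \<gamma>) \<cdot> snd P i"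
      by (rule Arr_Add_Comp[symmetric]) (use D H i in simp_all)
    also have "\<dots> = snd Q i \<cdot> onArr (F i) (\<delta> \<boxplus> \<gamma>)"
      unfolding inv using D i by simp
    also have "\<dots> = snd Q i \<cdot> onArr (F i) \<delta> \<boxplus> snd Q i \<cdot> onArr (F i) \<gamma>"
      using D H i by (simp add: fun_Add Arr_Comp_Add)
    also have "snd Q i \<cdot> onArr (F i) \<gamma> = \<gamma> \<cdot> snd P i"
      using equivariantD(4)[OF assms(3) i] by simp
    finally show "\<delta> \<cdot> snd P i \<boxplus> \<gamma> \<cdot> snd P i = snd Q i \<cdot> onArr (F i) \<delta> \<boxplus> \<gamma> \<cdot> snd P i" .
  qed
  then have "equivariant P Q \<delta>"
    using H by (simp add: equivariant_def)
  then show ?thesis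
    using inv by blast
qed

lemma category_extension: "category E"
proof
  show "Dom E x \<in> Obj E" "Cod E x \<in> Obj E" if "x \<in> Arr E" for x
    by (rule Arr_extensionE[OF that]; simp)+
  show "Id E P \<in> Hom E P P" if "P \<in> Obj E" for P
    using that equivariant_Id[OF ObjD(2)[OF that]] by (simp add: Hom_extension)
  show "Comp E y x \<in> Hom E P R" if "x \<in> Hom E P Q" "y \<in> Hom E Q R" for x y P Q R
    using that ObjD(2)[of P] ObjD(2)[of Q] ObjD(2)[of R]
    by (auto simp: Hom_extension intro: equivariant_Comp[of P Q R])
  show "Comp E x (Id E P) = x" "Comp E (Id E Q) x = x" if "x \<in> Hom E P Q" for x P Q
    using that equivariantD(1-3)[of P Q] by (auto simp: Hom_extension)
  show "Comp E (Comp E z y) x = Comp E z (Comp E y x)"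
    if "x \<in> Hom E P Q" "y \<in> Hom E Q R" "z \<in> Hom E R S" for x y z P Q R S
    using that equivariantD(1-3)[of P Q] equivariantD(1-3)[of Q R] equivariantD(1-3)[of R S]
    by (auto simp: Hom_extension Arr_Comp_assoc)
qed

lemma equivariant_Hom: "equivariant P Q \<gamma> \<Longrightarrow> \<gamma> \<in> Hom A (fst P) (fst Q)"
  by (simp add: equivariant_def Hom_def)

lemma preadditive_extension: "preadditive_category E"
proof (intro preadditive_category.intro preadditive_category_axioms.intro category_extension)
  fix P Q assume PQ: "P \<in> Obj E" "Q \<in> Obj E"
  note act = ObjD(2)[OF PQ(1)] ObjD(2)[OF PQ(2)]
  show "comm_group (hom_group E P Q)"
  proof (rule comm_groupI)
    fix x assume "x \<in> carrier (hom_group E P Q)"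
    then obtain \<gamma> where \<gamma>: "x = (P, \<gamma>, Q)" "equivariant P Q \<gamma>"
      by (auto simp: hom_group_def Hom_extension)
    show "\<one>\<^bsub>hom_group E P Q\<^esub> \<otimes>\<^bsub>hom_group E P Q\<^esub> x = x"
      using \<gamma> equivariantD[OF \<gamma>(2)] by (simp add: hom_group_def)
    show "\<exists>y\<in>carrier (hom_group E P Q). y \<otimes>\<^bsub>hom_group E P Q\<^esub> x = \<one>\<^bsub>hom_group E P Q\<^esub>"
    proof -
      obtain \<delta> where "equivariant P Q \<delta>" "\<delta> \<boxplus> \<gamma> = Zero A (fst P) (fst Q)"
        using equivariant_inverse[OF act \<gamma>(2)] by blast
      then show ?thesis
        using \<gamma>(1) PQ by (intro bexI[of _ "(P, \<delta>, Q)"]) (simp_all add: hom_group_def Hom_extension)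
    qed
  qed (use PQ equivariant_Zero[OF act] equivariant_Add[OF act] in
      \<open>auto simp: hom_group_def Hom_extension
        intro: Add_assoc[OF equivariant_Hom equivariant_Hom equivariant_Hom]
          Add_commute[OF equivariant_Hom equivariant_Hom]\<close>)
next
  show "Comp E z (Add E x y) = Add E (Comp E z x) (Comp E z y)"
    if "x \<in> Hom E P Q" "y \<in> Hom E P Q" "z \<in> Hom E Q R" for x y z P Q R
    using that equivariantD(1-3)[of P Q] equivariantD(1-3)[of Q R]
    by (auto simp: Hom_extension Arr_Comp_Add)
  show "Comp E (Add E y z) x = Add E (Comp E y x) (Comp E z x)"
    if "x \<in> Hom E P Q" "y \<in> Hom E Q R" "z \<in> Hom E Q R" for x y z P Q R
    using that equivariantD(1-3)[of P Q] equivariantD(1-3)[of Q R]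
    by (auto simp: Hom_extension Arr_Add_Comp)
qed

section \<open>Zero object and biproducts of the extension\<close>

lemma ex_zero_object_extension: "\<exists>Z. is_zero_object E Z"
proof -
  obtain N where N: "is_zero_object A N"
    using ex_zero_object by blast
  then have N': "N \<in> Obj A"
    by (simp add: is_zero_object_def)
  define Z where "Z = (N, restrict (\<lambda>i. Zero A (onObj (F i) N) N) {1..n})"
  have act: "actions Z"
    using N' by (simp add: Z_def actions_def)
  have "is_module Z"
    unfolding is_module_def
  proof (intro conjI ballI act)
    fix i j assume ij: "i \<in> {1..n}" "j \<in> {1..n}"
    \<comment> \<open>Both sides are parallel arrows into the zero object \<open>N\<close>, hence
      equal.\<close>
    show "snd Z i \<cdot> onArr (F i) (snd Z j) = composite_action Z i j"
      by (rule zero_objectD[OF N]) (use act actionsD[OF act] ij in \<open>simp_all add: Z_def\<close>)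
  qed
  then have Z: "Z \<in> Obj E"
    by (auto simp: Obj_extension Z_def)
  have "(\<exists>!x. x \<in> Hom E P Z) \<and> (\<exists>!x. x \<in> Hom E Z P)" if P: "P \<in> Obj E" for P
  proof (intro conjI ex1I)
    show "Zero E P Z \<in> Hom E P Z" "Zero E Z P \<in> Hom E Z P"
      using equivariant_Zero act ObjD(2)[OF P] P Z by (auto simp: Hom_extension)
    have fst_Z: "fst Z = N"
      by (simp add: Z_def)
    show "x = Zero E P Z" if x: "x \<in> Hom E P Z" for x
    proof -
      obtain \<gamma> where \<gamma>: "x = (P, \<gamma>, Z)" "equivariant P Z \<gamma>"
        using x by (auto simp: Hom_extension)
      have "\<gamma> = Zero A (fst P) N"
        by (rule zero_objectD[OF N]) (use equivariantD[OF \<gamma>(2)] N' fst_Z ObjD(3)[OF P] in simp_all)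
      then show ?thesis
        using \<gamma>(1) fst_Z by simp
    qed
    show "x = Zero E Z P" if x: "x \<in> Hom E Z P" for x
    proof -
      obtain \<gamma> where \<gamma>: "x = (Z, \<gamma>, P)" "equivariant Z P \<gamma>"
        using x by (auto simp: Hom_extension)
      have "\<gamma> = Zero A N (fst P)"
        by (rule zero_objectD[OF N]) (use equivariantD[OF \<gamma>(2)] N' fst_Z ObjD(3)[OF P] in simp_all)
      then show ?thesis
        using \<gamma>(1) fst_Z by simp
    qed
  qed
  then show ?thesis
    using Z unfolding is_zero_object_def by blast
qed

lemma ex_biproduct_extension:
  assumes P: "P \<in> Obj E" and Q: "Q \<in> Obj E"
  shows "\<exists>S i\<^sub>1 i\<^sub>2 p\<^sub>1 p\<^sub>2. is_biproduct E P Q S i\<^sub>1 i\<^sub>2 p\<^sub>1 p\<^sub>2"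
proof -
  note D = actionsD[OF ObjD(2)[OF P]] actionsD[OF ObjD(2)[OF Q]]
  obtain S i\<^sub>1 i\<^sub>2 p\<^sub>1 p\<^sub>2 where "is_biproduct A (fst P) (fst Q) S i\<^sub>1 i\<^sub>2 p\<^sub>1 p\<^sub>2"
    using ex_biproduct[OF D(1) D(5)] by blast
  then have S: "S \<in> Obj A"
    and H: "i\<^sub>1 \<in> Arr A" "Dom A i\<^sub>1 = fst P" "Cod A i\<^sub>1 = S"
      "i\<^sub>2 \<in> Arr A" "Dom A i\<^sub>2 = fst Q" "Cod A i\<^sub>2 = S"
      "p\<^sub>1 \<in> Arr A" "Dom A p\<^sub>1 = S" "Cod A p\<^sub>1 = fst P"
      "p\<^sub>2 \<in> Arr A" "Dom A p\<^sub>2 = S" "Cod A p\<^sub>2 = fst Q"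
    and eq: "p\<^sub>1 \<cdot> i\<^sub>1 = Id A (fst P)" "p\<^sub>2 \<cdot> i\<^sub>2 = Id A (fst Q)"
      "p\<^sub>2 \<cdot> i\<^sub>1 = Zero A (fst P) (fst Q)" "p\<^sub>1 \<cdot> i\<^sub>2 = Zero A (fst Q) (fst P)"
      "(i\<^sub>1 \<cdot> p\<^sub>1) \<boxplus> (i\<^sub>2 \<cdot> p\<^sub>2) = Id A S"
    by (auto simp: is_biproduct_def Hom_def)
  \<comment> \<open>This action is forced: equivariance of the projections prescribes
    \<open>p\<^sub>1 \<cdot> s i\<close> and \<open>p\<^sub>2 \<cdot> s i\<close>, and the
    decomposition of the identity of \<open>S\<close> recovers \<open>s i\<close> from them.\<close>
  define s where "s = (\<lambda>i\<in>{1..n}. i\<^sub>1 \<cdot> (snd P i \<cdot> onArr (F i) p\<^sub>1) \<boxplus> i\<^sub>2 \<cdot> (snd Q i \<cdot> onArr (F i) p\<^sub>2))"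
  have act: "actions (S, s)"
    using D H S by (simp add: actions_def s_def)
  \<comment> \<open>Associativity towards the left, which exposes the composites
    \<open>p \<cdot> i\<close> to the biproduct equations.\<close>
  have cancel: "p \<cdot> (i \<cdot> g) = (p \<cdot> i) \<cdot> g"
    if "p \<in> Arr A" "i \<in> Arr A" "g \<in> Arr A" "Cod A g = Dom A i" "Cod A i = Dom A p" for p i g
    using Arr_Comp_assoc that by simp
  have p1: "equivariant (S, s) P p\<^sub>1"
    unfolding equivariant_def
  proof (intro conjI ballI)
    fix i assume i: "i \<in> {1..n}"
    have "p\<^sub>1 \<cdot> s i = (p\<^sub>1 \<cdot> i\<^sub>1) \<cdot> (snd P i \<cdot> onArr (F i) p\<^sub>1) \<boxplus> (p\<^sub>1 \<cdot> i\<^sub>2) \<cdot> (snd Q i \<cdot> onArr (F i) p\<^sub>2)"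
      using i D H by (simp add: s_def Arr_Comp_Add cancel)
    then show "p\<^sub>1 \<cdot> snd (S, s) i = snd P i \<cdot> onArr (F i) p\<^sub>1"
      unfolding eq using i D H by simp
  qed (use H in simp_all)
  have p2: "equivariant (S, s) Q p\<^sub>2"
    unfolding equivariant_def
  proof (intro conjI ballI)
    fix i assume i: "i \<in> {1..n}"
    have "p\<^sub>2 \<cdot> s i = (p\<^sub>2 \<cdot> i\<^sub>1) \<cdot> (snd P i \<cdot> onArr (F i) p\<^sub>1) \<boxplus> (p\<^sub>2 \<cdot> i\<^sub>2) \<cdot> (snd Q i \<cdot> onArr (F i) p\<^sub>2)"
      using i D H by (simp add: s_def Arr_Comp_Add cancel)
    then show "p\<^sub>2 \<cdot> snd (S, s) i = snd Q i \<cdot> onArr (F i) p\<^sub>2"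
      unfolding eq using i D H by simp
  qed (use H in simp_all)
  \<comment> \<open>Gathers \<open>p\<^sub>1 \<cdot> g\<close> and
    \<open>p\<^sub>2 \<cdot> g\<close> under the functor. For \<open>g\<close> an injection these
    are an identity and a zero arrow, so one summand disappears.\<close>
  have absorb: "s i \<cdot> onArr (F i) g =
      i\<^sub>1 \<cdot> (snd P i \<cdot> onArr (F i) (p\<^sub>1 \<cdot> g)) \<boxplus> i\<^sub>2 \<cdot> (snd Q i \<cdot> onArr (F i) (p\<^sub>2 \<cdot> g))"
    if "i \<in> {1..n}" "g \<in> Arr A" "Cod A g = S" for i g
    using that D H by (simp add: s_def Arr_Add_Comp fun_Comp Arr_Comp_assoc)
  have i1: "equivariant P (S, s) i\<^sub>1" and i2: "equivariant Q (S, s) i\<^sub>2"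
    using D H S by (simp_all add: equivariant_def absorb eq)
  have jointly_monic: "f = g"
    if f: "f \<in> Arr A" "Cod A f = S" and g: "g \<in> Arr A" "Cod A g = S" and "Dom A f = Dom A g"
      and 1: "p\<^sub>1 \<cdot> f = p\<^sub>1 \<cdot> g" and 2: "p\<^sub>2 \<cdot> f = p\<^sub>2 \<cdot> g" for f g
  proof -
    \<comment> \<open>An arrow into \<open>S\<close> is determined by its two components.\<close>
    have "h = i\<^sub>1 \<cdot> (p\<^sub>1 \<cdot> h) \<boxplus> i\<^sub>2 \<cdot> (p\<^sub>2 \<cdot> h)" if "h \<in> Arr A" "Cod A h = S" for h
    proof -
      have "h = ((i\<^sub>1 \<cdot> p\<^sub>1) \<boxplus> (i\<^sub>2 \<cdot> p\<^sub>2)) \<cdot> h"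
        unfolding eq using that by simp
      then show ?thesis
        using that H by (simp add: Arr_Add_Comp Arr_Comp_assoc)
    qed
    then show ?thesis
      using f g 1 2 by metis
  qed
  have "is_module (S, s)"
  proof (rule is_module_lift[OF act, where \<P> = "{(P, p\<^sub>1), (Q, p\<^sub>2)}"])
    show "f = g" if "f \<in> Arr A" "g \<in> Arr A" "Dom A f = Dom A g" "Cod A f = fst (S, s)"
      "Cod A g = fst (S, s)" "\<And>R p. (R, p) \<in> {(P, p\<^sub>1), (Q, p\<^sub>2)} \<Longrightarrow> p \<cdot> f = p \<cdot> g" for f g
      using jointly_monic[of f g] that(1-5) that(6)[of P p\<^sub>1] that(6)[of Q p\<^sub>2] by simp
  qed (use p1 p2 ObjD[OF P] ObjD[OF Q] in auto)
  then have SE: "(S, s) \<in> Obj E"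
    by (auto simp: Obj_extension s_def)
  have "is_biproduct E P Q (S, s) (P, i\<^sub>1, (S, s)) (Q, i\<^sub>2, (S, s)) ((S, s), p\<^sub>1, P) ((S, s), p\<^sub>2, Q)"
    using SE P Q p1 p2 i1 i2 eq by (simp add: is_biproduct_def Hom_extension)
  then show ?thesis
    by blast
qed

section \<open>Kernels and cokernels: universal property and lifting of the structure\<close>

lemma is_kernel_extensionI:
  assumes k: "(P, k, Q) \<in> Arr E" and f: "(Q, f, R) \<in> Arr E" and ker: "is_kernel A k f"
  shows "is_kernel E (P, k, Q) (Q, f, R)"
proof -
  interpret E: preadditive_category E
    by (rule preadditive_extension)
  have P: "P \<in> Obj E" and Q: "Q \<in> Obj E" and R: "R \<in> Obj E"
    and k': "equivariant P Q k" and f': "equivariant Q R f"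
    using k f by (auto simp: Arr_extension)
  note D = actionsD[OF ObjD(2)[OF P]] actionsD[OF ObjD(2)[OF Q]] actionsD[OF ObjD(2)[OF R]]
    equivariantD[OF k'] equivariantD[OF f'] kernelD[OF ker]
  have mono: "is_mono A k"
    by (rule kernel_mono[OF ker])
  show ?thesis
  proof (rule E.kernelI)
    show "is_mono E (P, k, Q)"
      unfolding is_mono_def
    proof (intro conjI allI ballI impI k)
      fix W x y assume "x \<in> Hom E W (Dom E (P, k, Q))" "y \<in> Hom E W (Dom E (P, k, Q))"
        and "Comp E (P, k, Q) x = Comp E (P, k, Q) y"
      then obtain \<gamma> \<delta> where xy: "x = (W, \<gamma>, P)" "y = (W, \<delta>, P)"
        and \<gamma>: "equivariant W P \<gamma>" and \<delta>: "equivariant W P \<delta>" and "k \<cdot> \<gamma> = k \<cdot> \<delta>"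
        by (auto simp: Hom_extension)
      then have "\<gamma> = \<delta>"
        using D monoD[OF mono, of \<gamma> \<delta>] equivariantD(1-3)[OF \<gamma>] equivariantD(1-3)[OF \<delta>] by simp
      then show "x = y"
        using xy by simp
    qed
    fix x assume x_Arr: "x \<in> Arr E" "Cod E x = Dom E (Q, f, R)"
      and x0: "Comp E (Q, f, R) x = Zero E (Dom E x) (Cod E (Q, f, R))"
    obtain W h where x: "x = (W, h, Q)" and W: "W \<in> Obj E" and h: "equivariant W Q h"
      using Arr_extensionE[OF x_Arr(1)] x_Arr(2) by (metis extension_simps(1,2))
    note DW = actionsD[OF ObjD(2)[OF W]] and Dh = equivariantD[OF h]
    have "f \<cdot> h = Zero A (Dom A h) (Cod A f)"
      using x0 x Dh D by simp
    then obtain u where u: "u \<in> Arr A" "Dom A u = fst W" "Cod A u = fst P" "k \<cdot> u = h"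
      using kernel_factor[OF ker, of h] Dh D by auto
    \<comment> \<open>The factorization \<open>u\<close> comes from \<open>A\<close>; that it is
      equivariant is checked after composing with the monomorphism \<open>k\<close>, where it
      reduces to equivariance of \<open>h\<close> and of \<open>k\<close>.\<close>
    have "u \<cdot> snd W i = snd P i \<cdot> onArr (F i) u" if i: "i \<in> {1..n}" for i
    proof (rule monoD[OF mono])
      have "k \<cdot> (u \<cdot> snd W i) = (k \<cdot> u) \<cdot> snd W i"
        by (rule Arr_Comp_assoc[symmetric]) (use D DW u i in simp_all)
      also have "\<dots> = snd Q i \<cdot> onArr (F i) (k \<cdot> u)"
        using Dh(4)[OF i] u(4) by simp
      also have "\<dots> = snd Q i \<cdot> (onArr (F i) k \<cdot> onArr (F i) u)"
        using fun_Comp[OF i u(1), of k] D u by simp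
      also have "\<dots> = (snd Q i \<cdot> onArr (F i) k) \<cdot> onArr (F i) u"
        by (rule Arr_Comp_assoc[symmetric]) (use D DW u i in simp_all)
      also have "\<dots> = (k \<cdot> snd P i) \<cdot> onArr (F i) u"
        using equivariantD(4)[OF k' i] by simp
      also have "\<dots> = k \<cdot> (snd P i \<cdot> onArr (F i) u)"
        by (rule Arr_Comp_assoc) (use D DW u i in simp_all)
      finally show "k \<cdot> (u \<cdot> snd W i) = k \<cdot> (snd P i \<cdot> onArr (F i) u)" .
    qed (use D DW u i in simp_all)
    then have "(W, u, P) \<in> Arr E"
      using u W P by (simp add: Arr_extension equivariant_def)
    then show "\<exists>y\<in>Arr E. Dom E y = Dom E x \<and> Cod E y = Dom E (P, k, Q) \<and> Comp E (P, k, Q) y = x"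
      using u x by (intro bexI[of _ "(W, u, P)"]) auto
  qed (use f D in simp_all)
qed

text \<open>Equivariance of the factorization \<open>u\<close> compares arrows out of
  \<open>F i\<close> of the cokernel object, so the epimorphism to cancel is
  \<open>onArr (F i) q\<close>, not \<open>q\<close>. Right exactness thus enters already in the
  universal property.\<close>

lemma is_cokernel_extensionI:
  assumes f: "(P, f, Q) \<in> Arr E" and q: "(Q, q, R) \<in> Arr E" and coker: "is_cokernel A q f"
  shows "is_cokernel E (Q, q, R) (P, f, Q)"
proof -
  interpret E: preadditive_category E
    by (rule preadditive_extension)
  have P: "P \<in> Obj E" and Q: "Q \<in> Obj E" and R: "R \<in> Obj E"
    and f': "equivariant P Q f" and q': "equivariant Q R q"
    using q f by (auto simp: Arr_extension)
  note D = actionsD[OF ObjD(2)[OF P]] actionsD[OF ObjD(2)[OF Q]] actionsD[OF ObjD(2)[OF R]]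
    equivariantD[OF f'] equivariantD[OF q'] cokernelD[OF coker]
  have epi: "is_epi A q"
    by (rule cokernel_epi[OF coker])
  show ?thesis
  proof (rule E.cokernelI)
    show "is_epi E (Q, q, R)"
      unfolding is_epi_def
    proof (intro conjI allI ballI impI q)
      fix W x y assume "x \<in> Hom E (Cod E (Q, q, R)) W" "y \<in> Hom E (Cod E (Q, q, R)) W"
        and "Comp E x (Q, q, R) = Comp E y (Q, q, R)"
      then obtain \<gamma> \<delta> where xy: "x = (R, \<gamma>, W)" "y = (R, \<delta>, W)"
        and \<gamma>: "equivariant R W \<gamma>" and \<delta>: "equivariant R W \<delta>" and "\<gamma> \<cdot> q = \<delta> \<cdot> q"
        by (auto simp: Hom_extension)
      then have "\<gamma> = \<delta>"
        using D epiD[OF epi, of \<gamma> \<delta>] equivariantD(1-3)[OF \<gamma>] equivariantD(1-3)[OF \<delta>] by simp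
      then show "x = y"
        using xy by simp
    qed
    fix x assume x_Arr: "x \<in> Arr E" "Dom E x = Cod E (P, f, Q)"
      and x0: "Comp E x (P, f, Q) = Zero E (Dom E (P, f, Q)) (Cod E x)"
    obtain W h where x: "x = (Q, h, W)" and W: "W \<in> Obj E" and h: "equivariant Q W h"
      using Arr_extensionE[OF x_Arr(1)] x_Arr(2) by (metis extension_simps(1,2))
    note DW = actionsD[OF ObjD(2)[OF W]] and Dh = equivariantD[OF h]
    have "h \<cdot> f = Zero A (Dom A f) (Cod A h)"
      using x0 x Dh D by simp
    then obtain u where u: "u \<in> Arr A" "Dom A u = fst R" "Cod A u = fst W" "u \<cdot> q = h"
      using cokernel_factor[OF coker, of h] Dh D by auto
    have "u \<cdot> snd R i = snd W i \<cdot> onArr (F i) u" if i: "i \<in> {1..n}" for i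
    proof (rule epiD)
      show "is_epi A (onArr (F i) q)"
        by (rule cokernel_epi[OF fun_cokernel[OF i coker]])
      have "(u \<cdot> snd R i) \<cdot> onArr (F i) q = u \<cdot> (snd R i \<cdot> onArr (F i) q)"
        by (rule Arr_Comp_assoc) (use D DW u i in simp_all)
      also have "\<dots> = u \<cdot> (q \<cdot> snd Q i)"
        using equivariantD(4)[OF q' i] by simp
      also have "\<dots> = (u \<cdot> q) \<cdot> snd Q i"
        by (rule Arr_Comp_assoc[symmetric]) (use D DW u i in simp_all)
      also have "\<dots> = snd W i \<cdot> onArr (F i) (u \<cdot> q)"
        using Dh(4)[OF i] u(4) by simp
      also have "\<dots> = snd W i \<cdot> (onArr (F i) u \<cdot> onArr (F i) q)"
        using fun_Comp[OF i _ u(1), of q] D u by simp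
      also have "\<dots> = (snd W i \<cdot> onArr (F i) u) \<cdot> onArr (F i) q"
        by (rule Arr_Comp_assoc[symmetric]) (use D DW u i in simp_all)
      finally show "(u \<cdot> snd R i) \<cdot> onArr (F i) q = (snd W i \<cdot> onArr (F i) u) \<cdot> onArr (F i) q" .
    qed (use D DW u i in simp_all)
    then have "(R, u, W) \<in> Arr E"
      using u W R by (simp add: Arr_extension equivariant_def)
    then show "\<exists>y\<in>Arr E. Dom E y = Cod E (Q, q, R) \<and> Cod E y = Cod E x \<and> Comp E y (Q, q, R) = x"
      using u x by (intro bexI[of _ "(R, u, W)"]) auto
  qed (use f D in simp_all)
qed

text \<open>The restricted action exists because equivariance moves \<open>f\<close> under the
  functor, where \<open>onArr (F i) (f \<cdot> k)\<close> is zero by additivity; hence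
  \<open>f\<close> kills \<open>snd Q i \<cdot> onArr (F i) k\<close>.\<close>

lemma kernel_lift:
  assumes f: "(Q, f, R) \<in> Arr E" and ker: "is_kernel A k f"
  obtains P where "(P, k, Q) \<in> Arr E"
proof -
  have Q: "Q \<in> Obj E" and R: "R \<in> Obj E" and f': "equivariant Q R f"
    using f by (auto simp: Arr_extension)
  note D = actionsD[OF ObjD(2)[OF Q]] actionsD[OF ObjD(2)[OF R]] equivariantD[OF f'] kernelD[OF ker]
  have K: "Dom A k \<in> Obj A"
    using D Dom_in_Obj by simp
  have "\<exists>u. u \<in> Arr A \<and> Dom A u = onObj (F i) (Dom A k) \<and> Cod A u = Dom A k \<and>
      k \<cdot> u = snd Q i \<cdot> onArr (F i) k" if i: "i \<in> {1..n}" for i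
  proof -
    have "f \<cdot> (snd Q i \<cdot> onArr (F i) k) = (f \<cdot> snd Q i) \<cdot> onArr (F i) k"
      by (rule Arr_Comp_assoc[symmetric]) (use D i in simp_all)
    also have "\<dots> = (snd R i \<cdot> onArr (F i) f) \<cdot> onArr (F i) k"
      using equivariantD(4)[OF f' i] by simp
    also have "\<dots> = snd R i \<cdot> (onArr (F i) f \<cdot> onArr (F i) k)"
      by (rule Arr_Comp_assoc) (use D i in simp_all)
    also have "onArr (F i) f \<cdot> onArr (F i) k = onArr (F i) (f \<cdot> k)"
      by (rule fun_Comp[symmetric]) (use D i in simp_all)
    also have "snd R i \<cdot> \<dots> = Zero A (onObj (F i) (Dom A k)) (fst R)"
      using D K i by simp
    finally have zero: "f \<cdot> (snd Q i \<cdot> onArr (F i) k) = Zero A (onObj (F i) (Dom A k)) (fst R)" .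
    obtain v where "v \<in> Arr A" "Dom A v = Dom A (snd Q i \<cdot> onArr (F i) k)" "Cod A v = Dom A k"
        "k \<cdot> v = snd Q i \<cdot> onArr (F i) k"
      by (rule kernel_factor[OF ker, of "snd Q i \<cdot> onArr (F i) k"]) (use zero D i in simp_all)
    then show ?thesis
      using D i by (intro exI[of _ v]) simp
  qed
  then obtain u where u: "\<And>i. i \<in> {1..n} \<Longrightarrow> u i \<in> Arr A \<and> Dom A (u i) = onObj (F i) (Dom A k) \<and>
      Cod A (u i) = Dom A k \<and> k \<cdot> u i = snd Q i \<cdot> onArr (F i) k"
    by metis
  define P where "P = (Dom A k, restrict u {1..n})"
  have act: "actions P"
    using u K by (simp add: P_def actions_def)
  have k': "equivariant P Q k"
    using u D by (simp add: P_def equivariant_def)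
  have "is_module P"
  proof (rule is_module_lift[OF act, where \<P> = "{(Q, k)}"])
    show "g = h" if "g \<in> Arr A" "h \<in> Arr A" "Dom A g = Dom A h" "Cod A g = fst P" "Cod A h = fst P"
      "\<And>R p. (R, p) \<in> {(Q, k)} \<Longrightarrow> p \<cdot> g = p \<cdot> h" for g h
      by (rule monoD[OF kernel_mono[OF ker]]) (use that in \<open>simp_all add: P_def\<close>)
  qed (use k' ObjD[OF Q] in auto)
  then have "(P, k, Q) \<in> Arr E"
    using k' Q by (simp add: Arr_extension Obj_extension P_def)
  then show thesis
    by (rule that)
qed

text \<open>Equivariance of \<open>f\<close> shows that \<open>q \<cdot> snd Q i\<close> kills
  \<open>onArr (F i) f\<close>. As \<open>onArr (F i) q\<close> is a cokernel of that arrow, the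
  action descends; here right exactness gives existence and not merely cancellation.\<close>

lemma cokernel_lift:
  assumes f: "(P, f, Q) \<in> Arr E" and coker: "is_cokernel A q f"
  obtains R where "(Q, q, R) \<in> Arr E"
proof -
  have P: "P \<in> Obj E" and Q: "Q \<in> Obj E" and f': "equivariant P Q f"
    using f by (auto simp: Arr_extension)
  note D = actionsD[OF ObjD(2)[OF P]] actionsD[OF ObjD(2)[OF Q]] equivariantD[OF f']
    cokernelD[OF coker]
  have K: "Cod A q \<in> Obj A"
    using D Cod_in_Obj by simp
  have "\<exists>u. u \<in> Arr A \<and> Dom A u = onObj (F i) (Cod A q) \<and> Cod A u = Cod A q \<and>
      u \<cdot> onArr (F i) q = q \<cdot> snd Q i" if i: "i \<in> {1..n}" for i
  proof -
    have "(q \<cdot> snd Q i) \<cdot> onArr (F i) f = q \<cdot> (snd Q i \<cdot> onArr (F i) f)"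
      by (rule Arr_Comp_assoc) (use D i in simp_all)
    also have "\<dots> = q \<cdot> (f \<cdot> snd P i)"
      using equivariantD(4)[OF f' i] by simp
    also have "\<dots> = (q \<cdot> f) \<cdot> snd P i"
      by (rule Arr_Comp_assoc[symmetric]) (use D i in simp_all)
    also have "\<dots> = Zero A (onObj (F i) (fst P)) (Cod A q)"
      using D K i by simp
    finally have zero: "(q \<cdot> snd Q i) \<cdot> onArr (F i) f = Zero A (onObj (F i) (fst P)) (Cod A q)" .
    obtain v where "v \<in> Arr A" "Dom A v = Cod A (onArr (F i) q)" "Cod A v = Cod A (q \<cdot> snd Q i)"
        "v \<cdot> onArr (F i) q = q \<cdot> snd Q i"
      by (rule cokernel_factor[OF fun_cokernel[OF i coker], of "q \<cdot> snd Q i"])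
        (use zero D i in simp_all)
    then show ?thesis
      using D i by (intro exI[of _ v]) simp
  qed
  then obtain u where u: "\<And>i. i \<in> {1..n} \<Longrightarrow> u i \<in> Arr A \<and> Dom A (u i) = onObj (F i) (Cod A q) \<and>
      Cod A (u i) = Cod A q \<and> u i \<cdot> onArr (F i) q = q \<cdot> snd Q i"
    by metis
  define R where "R = (Cod A q, restrict u {1..n})"
  have act: "actions R"
    using u K by (simp add: R_def actions_def)
  have q': "equivariant Q R q"
    using u D by (simp add: R_def equivariant_def)
  have "is_module R"
    by (rule is_module_descend[OF ObjD(1)[OF Q] act q' coker])
  then have "(Q, q, R) \<in> Arr E"
    using q' Q by (simp add: Arr_extension Obj_extension R_def)
  then show thesis
    by (rule that)
qed

section \<open>Monomorphisms and epimorphisms of the extension, and the abelian axioms\<close>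

lemma mono_extensionD:
  assumes "is_mono E (P, f, Q)"
  shows "is_mono A f"
proof (rule monoI)
  have f: "(P, f, Q) \<in> Arr E"
    using assms by (simp add: is_mono_def)
  then have P: "P \<in> Obj E" and Q: "Q \<in> Obj E" and f': "equivariant P Q f"
    by (auto simp: Arr_extension)
  note D = equivariantD[OF f']
  show "f \<in> Arr A"
    by (rule D)
  \<comment> \<open>In the extension \<open>f\<close> composes to zero both with the lifted kernel
    and with the zero arrow, so monicity makes \<open>k\<close> zero. Every arrow of
    \<open>A\<close> killed by \<open>f\<close> factors through \<open>k\<close> and is zero as
    well.\<close>
  obtain k where ker: "is_kernel A k f"
    using ex_kernel D by blast
  obtain K where k: "(K, k, P) \<in> Arr E"
    using kernel_lift[OF f ker] .
  then have K: "K \<in> Obj E" and k': "equivariant K P k"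
    by (auto simp: Arr_extension)
  have obj: "fst K \<in> Obj A" "fst P \<in> Obj A" "fst Q \<in> Obj A"
    using K P Q ObjD(3) by auto
  have "(K, k, P) \<in> Hom E K P" "Zero E K P \<in> Hom E K P"
    using k k' K P equivariant_Zero[OF ObjD(2) ObjD(2)] by (auto simp: Hom_extension)
  moreover have "Comp E (P, f, Q) (K, k, P) = Comp E (P, f, Q) (Zero E K P)"
    using kernelD[OF ker] D equivariantD[OF k'] obj by simp
  ultimately have "(K, k, P) = Zero E K P"
    using assms unfolding is_mono_def by (metis extension_simps(1))
  then have k0: "k = Zero A (fst K) (fst P)"
    by simp
  fix h assume h: "h \<in> Arr A" "Cod A h = Dom A f" "f \<cdot> h = Zero A (Dom A h) (Cod A f)"
  obtain u where "u \<in> Arr A" "Dom A u = Dom A h" "Cod A u = Dom A k" "k \<cdot> u = h"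
    using kernel_factor[OF ker h] .
  then show "h = Zero A (Dom A h) (Dom A f)"
    using k0 obj D by auto
qed

text \<open>The test arrow is now the lifted cokernel of \<open>f\<close>, which must vanish; the
  lift relies on right exactness.\<close>

lemma epi_extensionD:
  assumes "is_epi E (P, f, Q)"
  shows "is_epi A f"
proof (rule epiI)
  have f: "(P, f, Q) \<in> Arr E"
    using assms by (simp add: is_epi_def)
  then have P: "P \<in> Obj E" and Q: "Q \<in> Obj E" and f': "equivariant P Q f"
    by (auto simp: Arr_extension)
  note D = equivariantD[OF f']
  show "f \<in> Arr A"
    by (rule D)
  obtain q where coker: "is_cokernel A q f"
    using ex_cokernel D by blast
  obtain R where q: "(Q, q, R) \<in> Arr E"
    using cokernel_lift[OF f coker] .
  then have R: "R \<in> Obj E" and q': "equivariant Q R q"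
    by (auto simp: Arr_extension)
  have obj: "fst R \<in> Obj A" "fst P \<in> Obj A" "fst Q \<in> Obj A"
    using R P Q ObjD(3) by auto
  have "(Q, q, R) \<in> Hom E Q R" "Zero E Q R \<in> Hom E Q R"
    using q q' R Q equivariant_Zero[OF ObjD(2) ObjD(2)] by (auto simp: Hom_extension)
  moreover have "Comp E (Q, q, R) (P, f, Q) = Comp E (Zero E Q R) (P, f, Q)"
    using cokernelD[OF coker] D equivariantD[OF q'] obj by simp
  ultimately have "(Q, q, R) = Zero E Q R"
    using assms unfolding is_epi_def by (metis extension_simps(2))
  then have q0: "q = Zero A (fst Q) (fst R)"
    by simp
  fix h assume h: "h \<in> Arr A" "Dom A h = Cod A f" "h \<cdot> f = Zero A (Dom A f) (Cod A h)"
  obtain u where "u \<in> Arr A" "Dom A u = Cod A q" "Cod A u = Cod A h" "u \<cdot> q = h"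
    using cokernel_factor[OF coker h] .
  then show "h = Zero A (Cod A f) (Cod A h)"
    using q0 obj D by auto
qed

lemma abelian_extension: "abelian_category E"
proof -
  interpret E: preadditive_category E
    by (rule preadditive_extension)
  show ?thesis
  proof
    show "\<exists>Z. is_zero_object E Z"
      by (rule ex_zero_object_extension)
    show "\<exists>S i\<^sub>1 i\<^sub>2 p\<^sub>1 p\<^sub>2. is_biproduct E P Q S i\<^sub>1 i\<^sub>2 p\<^sub>1 p\<^sub>2" if "P \<in> Obj E" "Q \<in> Obj E" for P Q
      using that by (rule ex_biproduct_extension)
  next
    fix x assume x: "x \<in> Arr E"
    then obtain P f Q where x_eq: "x = (P, f, Q)" and f: "(P, f, Q) \<in> Arr E" "f \<in> Arr A"
      by (metis Arr_extensionE equivariantD(1))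
    obtain k where k: "is_kernel A k f"
      using ex_kernel[OF f(2)] ..
    obtain K where "(K, k, P) \<in> Arr E"
      using kernel_lift[OF f(1) k] .
    then show "\<exists>y. is_kernel E y x"
      using is_kernel_extensionI f(1) k x_eq by blast
    obtain q where q: "is_cokernel A q f"
      using ex_cokernel[OF f(2)] ..
    obtain R where "(Q, q, R) \<in> Arr E"
      using cokernel_lift[OF f(1) q] .
    then show "\<exists>y. is_cokernel E y x"
      using is_cokernel_extensionI f(1) q x_eq by blast
  next
    fix x assume x: "is_mono E x"
    then have "x \<in> Arr E"
      by (simp add: is_mono_def)
    then obtain P f Q where x_eq: "x = (P, f, Q)" and f: "(P, f, Q) \<in> Arr E" "f \<in> Arr A"
      by (metis Arr_extensionE equivariantD(1))
    \<comment> \<open>A cokernel of \<open>f\<close> in \<open>A\<close> lifts to the extension, and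
      \<open>f\<close>, being monic in \<open>A\<close>, is its kernel there;
      \<open>is_kernel_extensionI\<close> transfers this back.\<close>
    obtain q where q: "is_cokernel A q f"
      using ex_cokernel[OF f(2)] ..
    obtain R where "(Q, q, R) \<in> Arr E"
      using cokernel_lift[OF f(1) q] .
    moreover have "is_kernel A f q"
      using mono_kernel_of_cokernel[OF mono_extensionD q] x x_eq by blast
    ultimately show "\<exists>y. is_kernel E x y"
      using is_kernel_extensionI f(1) x_eq by blast
  next
    fix x assume x: "is_epi E x"
    then have "x \<in> Arr E"
      by (simp add: is_epi_def)
    then obtain P f Q where x_eq: "x = (P, f, Q)" and f: "(P, f, Q) \<in> Arr E" "f \<in> Arr A"
      by (metis Arr_extensionE equivariantD(1))
    obtain k where k: "is_kernel A k f"
      using ex_kernel[OF f(2)] ..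
    obtain K where "(K, k, P) \<in> Arr E"
      using kernel_lift[OF f(1) k] .
    moreover have "is_cokernel A f k"
      using epi_cokernel_of_kernel[OF epi_extensionD k] x x_eq by blast
    ultimately show "\<exists>y. is_cokernel E x y"
      using is_cokernel_extensionI f(1) x_eq by blast
  qed
qed

end

theorem proposition2p1:
  fixes A :: "('o, 'm) cat" and n :: nat
    and F :: "nat \<Rightarrow> ('o, 'm, 'o, 'm) cat_fun"
    and \<Phi> :: "nat \<Rightarrow> nat \<Rightarrow> 'o \<Rightarrow> 'm"
  assumes "abelian_category A"
    and "n \<ge> 1"
    and "\<And>i. i \<in> {1..n} \<Longrightarrow> additive_functor A A (F i)"
    and "natural_family A n F \<Phi>"
    and "associative_family A n F \<Phi>"
    and "\<And>i. i \<in> {1..n} \<Longrightarrow> right_exact A A (F i)"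
  shows "abelian_category (right_trivial_extension A n F \<Phi>)"
proof -
  interpret right_exact_family A n F \<Phi>
    by (intro right_exact_family.intro right_exact_family_axioms.intro assms)
  show ?thesis
    by (rule abelian_extension)
qed

end
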